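(* Let $A$ be a bounded self-adjoint operator on a separable (infinite-dimensional) Hilbert space $\mathbb{H}$ with orthonormal basis $\{e_1,e_2,\ldots\}$, and let $\lambda_{n1}\ge\lambda_{n2}\ge\cdots\ge\lambda_{nn}$ be the eigenvalues of the truncation $A_n$ arranged in decreasing order. For each positive integer $n$, let $\{w_{nk}: k=1,2,\ldots,n\}$ be a set of numbers such that $0\le w_{nk}\le 1$ and $\sum_{k=1}^n w_{nk}=1$. Suppose there exist $\delta>0$ and $K>0$ such that, for every $n$, $$\#\left\{\lambda_{nj} : \left|\sum_{k=1}^n w_{nk}\lambda_{nk}-\lambda_{nj}\right|<\delta\right\}<K,$$ and suppose in addition that $\sigma_e(A)$ and $\sigma(A)$ have the same upper and lower bounds. Then $\sigma_e(A)$ has a gap.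
   Context: $P_n$ is the orthogonal projection of $\mathbb{H}$ onto the span of $\{e_1,\ldots,e_n\}$, and $A_n=P_nAP_n$, regarded as an operator (an $n\times n$ matrix) on that span. $\sigma(A)$ is the spectrum and $\sigma_e(A)$ the essential spectrum of $A$; their lower and upper bounds are their infimum and supremum. Eigenvalues are counted with multiplicity, and $\#S$ is the number of elements of $S$ (here: the number of indices $j\in\{1,\dots,n\}$ satisfying the inequality). A gap in $\sigma_e(A)$ is a nonempty open interval lying between the lower and upper bounds of $\sigma_e(A)$ and containing no point of $\sigma_e(A)$ (it may contain discrete eigenvalues of $A$). *)

theory Defs
  imports "HOL-Analysis.Elementary_Normed_Spaces" "Jordan_Normal_Form.Char_Poly"
begin

(* Complex Hilbert spaces. The inner product is linear in its first argument, and
   cinner_self makes it positive definite. *)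
class complex_hilbert_space = banach +
  fixes scaleC :: "complex \<Rightarrow> 'a \<Rightarrow> 'a" (infixr "*\<^sub>C" 75)
    and cinner :: "'a \<Rightarrow> 'a \<Rightarrow> complex"
  assumes scaleC_add_right: "c *\<^sub>C (x + y) = c *\<^sub>C x + c *\<^sub>C y"
    and scaleC_add_left: "(c + d) *\<^sub>C x = c *\<^sub>C x + d *\<^sub>C x"
    and scaleC_scaleC: "c *\<^sub>C d *\<^sub>C x = (c * d) *\<^sub>C x"
    and scaleR_scaleC: "r *\<^sub>R x = complex_of_real r *\<^sub>C x"
    and cinner_commute: "cinner x y = cnj (cinner y x)"
    and cinner_add_left: "cinner (x + y) z = cinner x z + cinner y z"
    and cinner_scaleC_left: "cinner (c *\<^sub>C x) y = c * cinner x y"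
    and cinner_self: "cinner x x = complex_of_real ((norm x)\<^sup>2)"

interpretation complex_vector: vector_space
  "scaleC :: complex \<Rightarrow> 'a \<Rightarrow> 'a::complex_hilbert_space"
proof
  show "1 *\<^sub>C x = x" for x :: 'a
    using scaleR_scaleC[of 1 x] by simp
qed (fact scaleC_add_right scaleC_add_left scaleC_scaleC)+

abbreviation cspan :: "'a::complex_hilbert_space set \<Rightarrow> 'a set"
  where "cspan \<equiv> complex_vector.span"

definition orthonormal_basis :: "(nat \<Rightarrow> 'a::complex_hilbert_space) \<Rightarrow> bool"
  where "orthonormal_basis e \<longleftrightarrow>
    (\<forall>i j. cinner (e i) (e j) = (if i = j then 1 else 0)) \<and> closure (cspan (range e)) = UNIV"

definition bounded_clinear :: "('a::complex_hilbert_space \<Rightarrow> 'a) \<Rightarrow> bool"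
  where "bounded_clinear T \<longleftrightarrow> bounded_linear T \<and> (\<forall>c x. T (c *\<^sub>C x) = c *\<^sub>C T x)"

definition self_adjoint :: "('a::complex_hilbert_space \<Rightarrow> 'a) \<Rightarrow> bool"
  where "self_adjoint T \<longleftrightarrow> (\<forall>x y. cinner (T x) y = cinner x (T y))"

definition op_spectrum :: "('a::complex_hilbert_space \<Rightarrow> 'a) \<Rightarrow> complex set"
  where "op_spectrum T =
    {z. \<not> (\<exists>R. bounded_clinear R \<and> (\<forall>x. R (T x - z *\<^sub>C x) = x) \<and> (\<forall>x. T (R x) - z *\<^sub>C R x = x))}"

(* Finite-dimensional kernel, closed range, range of finite codimension. *)
definition fredholm :: "('a::complex_hilbert_space \<Rightarrow> 'a) \<Rightarrow> bool"
  where "fredholm T \<longleftrightarrow> bounded_clinear T \<and>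
    (\<exists>B. finite B \<and> {x. T x = 0} \<subseteq> cspan B) \<and>
    closed (range T) \<and>
    (\<exists>B. finite B \<and> cspan (range T \<union> B) = UNIV)"

definition essential_spectrum :: "('a::complex_hilbert_space \<Rightarrow> 'a) \<Rightarrow> complex set"
  where "essential_spectrum T = {z. \<not> fredholm (\<lambda>x. T x - z *\<^sub>C x)}"

(* Both spectra of a self-adjoint operator lie on the real axis; real_points reads such a
   set as a set of reals, so that infimum, supremum and intervals make sense. *)
definition real_points :: "complex set \<Rightarrow> real set"
  where "real_points S = {t. complex_of_real t \<in> S}"

definition has_gap :: "real set \<Rightarrow> bool"
  where "has_gap S \<longleftrightarrow> (\<exists>a b. a < b \<and> Inf S \<le> a \<and> b \<le> Sup S \<and> {a<..<b} \<inter> S = {})"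

definition orthogonal_projection :: "'a::complex_hilbert_space set \<Rightarrow> 'a \<Rightarrow> 'a"
  where "orthogonal_projection M x = (THE y. y \<in> M \<and> (\<forall>z\<in>M. cinner (x - y) z = 0))"

(* Indices start at 0: e 0, ..., e (n - 1) are the first n basis vectors. *)
definition truncation :: "('a::complex_hilbert_space \<Rightarrow> 'a) \<Rightarrow> (nat \<Rightarrow> 'a) \<Rightarrow> nat \<Rightarrow> 'a \<Rightarrow> 'a"
  where "truncation A e n =
    orthogonal_projection (cspan (e ` {..<n})) \<circ> A \<circ> orthogonal_projection (cspan (e ` {..<n}))"

(* The matrix, in the basis e 0, ..., e (n - 1), of the truncation restricted to their span:
   entry (i, j) is the i-th coordinate of the image of e j. *)
definition truncation_matrix ::
    "('a::complex_hilbert_space \<Rightarrow> 'a) \<Rightarrow> (nat \<Rightarrow> 'a) \<Rightarrow> nat \<Rightarrow> complex mat"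
  where "truncation_matrix A e n = mat n n (\<lambda>(i, j). cinner (truncation A e n (e j)) (e i))"

(* l 0 \<ge> ... \<ge> l (n - 1) are the eigenvalues of the n x n matrix M, repeated according to
   their (algebraic) multiplicity. *)
definition decreasing_eigenvalues :: "nat \<Rightarrow> complex mat \<Rightarrow> (nat \<Rightarrow> real) \<Rightarrow> bool"
  where "decreasing_eigenvalues n M l \<longleftrightarrow>
    (\<forall>i j. i \<le> j \<longrightarrow> j < n \<longrightarrow> l j \<le> l i) \<and>
    char_poly M = (\<Prod>k<n. [:- complex_of_real (l k), 1:])"

end

theory Submission
  imports Defs "Jordan_Normal_Form.Schur_Decomposition"
begin

text \<open>
  Let \<open>a\<^sub>n\<close> be the weighted mean of the eigenvalues of the truncation \<open>A\<^sub>n\<close>, and let \<open>[m, M]\<close> be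
  the smallest closed interval that contains the spectrum, which by assumption is also the
  smallest one that contains the essential spectrum. The eigenvalues of \<open>A\<^sub>n\<close> are values of the
  quadratic form of \<open>A\<close> at unit vectors, so they lie in \<open>[m, M]\<close>
  (\<open>eigenvalue_between_spectrum_bounds\<close>); so do their means \<open>a\<^sub>n\<close>, which therefore have a cluster
  point \<open>c\<close> in \<open>[m, M]\<close>. Whenever \<open>a\<^sub>n\<close> is within \<open>\<delta>/2\<close> of \<open>c\<close>, the interval \<open>(c - \<delta>/2, c + \<delta>/2)\<close>
  contains fewer than \<open>K\<close> eigenvalues of \<open>A\<^sub>n\<close>. But near each point of the essential spectrum the
  number of eigenvalues of \<open>A\<^sub>n\<close> tends to infinity (\<open>many_eigenvalues_near_essential_spectrum\<close>).
  So \<open>(c - \<delta>/2, c + \<delta>/2)\<close> misses the essential spectrum. It lies inside \<open>[m, M]\<close>, since \<open>c\<close> does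
  and the endpoints \<open>m\<close> and \<open>M\<close> are limits of points of the essential spectrum, which is nonempty
  (\<open>essential_spectrum_nonempty\<close>).

  The link between the essential spectrum and the truncations is Weyl's criterion
  (\<open>fredholm_iff_not_weyl_singular\<close>): a bounded self-adjoint operator is Fredholm if and only if
  it is bounded below in norm on the orthogonal complement of some finite set. In the proof,
  invertibility comes from coercivity and the Banach fixed point theorem, and the converse from a
  series of approximate null vectors with rapidly growing weights. On the side of the truncations,
  an orthonormal eigenbasis of \<open>A\<^sub>n\<close> (\<open>truncation_orthonormal_eigenbasis\<close>) and a dimension count
  show that \<open>N\<close> orthonormal approximate null vectors of \<open>A - t\<close> force \<open>N\<close> eigenvalues near \<open>t\<close>.
\<close>

section \<open>Inner product algebra\<close>

lemma cinner_zero_left [simp]: "cinner 0 (y::'a::complex_hilbert_space) = 0"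
  using cinner_add_left[of 0 0 y] by simp

lemma cinner_minus_left [simp]: "cinner (- x) y = - cinner x (y::'a::complex_hilbert_space)"
  using cinner_add_left[of "- x" x y] by (simp add: eq_neg_iff_add_eq_0)

lemma cinner_diff_left: "cinner (x - y) z = cinner x z - cinner y (z::'a::complex_hilbert_space)"
  using cinner_add_left[of x "- y" z] by simp

lemma cinner_sum_left: "cinner (\<Sum>i\<in>I. f i) (y::'a::complex_hilbert_space) = (\<Sum>i\<in>I. cinner (f i) y)"
  by (induction I rule: infinite_finite_induct) (auto simp: cinner_add_left)

lemma cinner_add_right: "cinner x (y + z) = cinner x y + cinner x (z::'a::complex_hilbert_space)"
  by (metis cinner_add_left cinner_commute complex_cnj_add)

lemma cinner_scaleC_right: "cinner x (c *\<^sub>C y) = cnj c * cinner x (y::'a::complex_hilbert_space)"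
  by (metis cinner_scaleC_left cinner_commute complex_cnj_mult)

lemma cinner_zero_right [simp]: "cinner (x::'a::complex_hilbert_space) 0 = 0"
  by (metis cinner_zero_left cinner_commute complex_cnj_zero)

lemma cinner_minus_right [simp]: "cinner x (- y) = - cinner x (y::'a::complex_hilbert_space)"
  by (metis cinner_minus_left cinner_commute complex_cnj_minus)

lemma cinner_diff_right: "cinner x (y - z) = cinner x y - cinner x (z::'a::complex_hilbert_space)"
  by (metis cinner_diff_left cinner_commute complex_cnj_diff)

lemma cinner_sum_right: "cinner (y::'a::complex_hilbert_space) (\<Sum>i\<in>I. f i) = (\<Sum>i\<in>I. cinner y (f i))"
  by (induction I rule: infinite_finite_induct) (auto simp: cinner_add_right)

lemma cinner_scaleR_left: "cinner (r *\<^sub>R x) y = of_real r * cinner x (y::'a::complex_hilbert_space)"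
  by (simp add: scaleR_scaleC cinner_scaleC_left)

lemma cinner_scaleR_right: "cinner x (r *\<^sub>R y) = of_real r * cinner x (y::'a::complex_hilbert_space)"
  by (simp add: scaleR_scaleC cinner_scaleC_right)

lemmas cinner_algebra = cinner_add_left cinner_add_right cinner_diff_left cinner_diff_right
  cinner_scaleC_left cinner_scaleC_right cinner_scaleR_left cinner_scaleR_right
  cinner_sum_left cinner_sum_right

lemma cinner_eq_0_commute: "cinner x y = 0 \<longleftrightarrow> cinner y (x::'a::complex_hilbert_space) = 0"
  by (metis cinner_commute complex_cnj_zero)

lemma norm_square_cinner: "(norm x)\<^sup>2 = Re (cinner x (x::'a::complex_hilbert_space))"
  by (simp add: cinner_self)

lemma norm_add_square:
  "(norm (x + y))\<^sup>2 = (norm x)\<^sup>2 + 2 * Re (cinner x y) + (norm (y::'a::complex_hilbert_space))\<^sup>2"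
proof -
  have "Re (cinner y x) = Re (cinner x y)"
    by (subst cinner_commute) simp
  then show ?thesis
    by (simp add: norm_square_cinner cinner_algebra)
qed

lemma norm_scaleC: "norm (c *\<^sub>C x) = cmod c * norm (x::'a::complex_hilbert_space)"
proof -
  have "cinner (c *\<^sub>C x) (c *\<^sub>C x) = of_real ((cmod c)\<^sup>2 * (norm x)\<^sup>2)"
    by (simp only: cinner_scaleC_left cinner_scaleC_right)
      (simp add: cinner_self mult.commute[of "cnj c"] complex_norm_square[symmetric] flip: mult.assoc)
  then have "(norm (c *\<^sub>C x))\<^sup>2 = (cmod c * norm x)\<^sup>2"
    unfolding norm_square_cinner power_mult_distrib by simp
  then show ?thesis
    by (simp add: power2_eq_iff_nonneg)
qed

lemma cauchy_schwarz: "cmod (cinner x y) \<le> norm x * norm (y::'a::complex_hilbert_space)"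
proof (cases "y = 0")
  case False
  define c where "c = cinner x y / of_real ((norm y)\<^sup>2)"
  have yy: "(norm y)\<^sup>2 > 0"
    using False by simp
  have "cinner (x - c *\<^sub>C y) (x - c *\<^sub>C y) =
      cinner x x - cnj c * cinner x y - c * cinner y x + c * cnj c * cinner y y"
    by (simp add: cinner_algebra algebra_simps)
  also have "c * cinner y x = c * cnj (cinner x y)"
    by (subst cinner_commute) simp
  also have "c * cnj c * cinner y y = c * cnj (cinner x y)"
    using False by (simp add: c_def cinner_self power2_eq_square)
  also have "cnj c * cinner x y = of_real ((cmod (cinner x y))\<^sup>2 / (norm y)\<^sup>2)"
    by (simp add: c_def complex_norm_square[symmetric] mult.commute)
  finally have "cinner (x - c *\<^sub>C y) (x - c *\<^sub>C y) =
      of_real ((norm x)\<^sup>2 - (cmod (cinner x y))\<^sup>2 / (norm y)\<^sup>2)"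
    by (simp add: cinner_self)
  then have "(norm (x - c *\<^sub>C y))\<^sup>2 = (norm x)\<^sup>2 - (cmod (cinner x y))\<^sup>2 / (norm y)\<^sup>2"
    by (metis cinner_self of_real_eq_iff)
  then have "(cmod (cinner x y))\<^sup>2 / (norm y)\<^sup>2 \<le> (norm x)\<^sup>2"
    by (metis diff_ge_0_iff_ge zero_le_power2)
  then have "(cmod (cinner x y))\<^sup>2 \<le> (norm x * norm y)\<^sup>2"
    using yy by (simp add: divide_simps power_mult_distrib)
  then show ?thesis
    by (simp add: power2_le_iff_abs_le)
qed simp

lemma bounded_linear_cinner_left: "bounded_linear (\<lambda>x. cinner x (y::'a::complex_hilbert_space))"
  by (rule bounded_linear_intro[where K = "norm y"])
    (simp_all add: cinner_algebra scaleR_conv_of_real cauchy_schwarz)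

lemma cinner_cspan_zero:
  assumes "x \<in> cspan F" and "\<And>f. f \<in> F \<Longrightarrow> cinner f (y::'a::complex_hilbert_space) = 0"
  shows "cinner x y = 0"
  using assms(1)
  by (induction rule: complex_vector.span_induct_alt) (auto simp: cinner_algebra assms(2))

lemma cinner_cspan_zero':
  assumes "x \<in> cspan F" and "\<And>f. f \<in> F \<Longrightarrow> cinner (y::'a::complex_hilbert_space) f = 0"
  shows "cinner y x = 0"
  using assms cinner_cspan_zero[of x F y] cinner_eq_0_commute by blast

section \<open>Orthonormal systems\<close>

definition orthonormal_on :: "nat set \<Rightarrow> (nat \<Rightarrow> 'a::complex_hilbert_space) \<Rightarrow> bool"
  where "orthonormal_on I u \<longleftrightarrow> (\<forall>i\<in>I. \<forall>j\<in>I. cinner (u i) (u j) = (if i = j then 1 else 0))"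

lemma cinner_orthonormal_combination:
  assumes "orthonormal_on I u" "finite I" "k \<in> I"
  shows "cinner (\<Sum>i\<in>I. c i *\<^sub>C u i) (u k) = c k"
proof -
  have "cinner (\<Sum>i\<in>I. c i *\<^sub>C u i) (u k) = (\<Sum>i\<in>I. if i = k then c i else 0)"
    unfolding cinner_algebra using assms
    by (intro sum.cong) (auto simp: orthonormal_on_def)
  then show ?thesis
    using assms by simp
qed

lemma norm_orthonormal_combination:
  assumes "orthonormal_on I u" "finite I"
  shows "(norm (\<Sum>i\<in>I. c i *\<^sub>C u i))\<^sup>2 = (\<Sum>i\<in>I. (cmod (c i))\<^sup>2)"
proof -
  have "cinner (\<Sum>i\<in>I. c i *\<^sub>C u i) (\<Sum>i\<in>I. c i *\<^sub>C u i) = (\<Sum>i\<in>I. c i * cnj (c i))"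
    by (subst cinner_sum_right)
      (simp add: cinner_scaleC_right cinner_orthonormal_combination assms mult.commute)
  then show ?thesis
    unfolding norm_square_cinner by (simp add: complex_norm_square[symmetric] flip: of_real_power)
qed

lemma coefficient_le_norm:
  assumes "orthonormal_on I u" "finite I" "k \<in> I"
  shows "cmod (c k) \<le> norm (\<Sum>i\<in>I. c i *\<^sub>C u i)"
proof -
  have "(cmod (c k))\<^sup>2 \<le> (\<Sum>i\<in>I. (cmod (c i))\<^sup>2)"
    using assms by (intro member_le_sum) auto
  then show ?thesis
    by (simp add: norm_orthonormal_combination[OF assms(1,2), symmetric] power2_le_iff_abs_le)
qed

lemma bessel_inequality:
  assumes "orthonormal_on I u" "finite I"
  shows "(\<Sum>i\<in>I. (cmod (cinner x (u i)))\<^sup>2) \<le> (norm x)\<^sup>2"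
proof -
  define p where "p = (\<Sum>i\<in>I. cinner x (u i) *\<^sub>C u i)"
  have "cinner (u i) (x - p) = 0" if "i \<in> I" for i
  proof -
    have "cinner (x - p) (u i) = 0"
      unfolding p_def by (simp add: cinner_diff_left cinner_orthonormal_combination[OF assms that])
    then show ?thesis
      by (simp add: cinner_eq_0_commute[of "u i"])
  qed
  then have "cinner (\<Sum>i\<in>I. cinner x (u i) *\<^sub>C u i) (x - p) = 0"
    by (simp add: cinner_sum_left cinner_scaleC_left)
  then have "cinner p (x - p) = 0"
    by (simp add: p_def)
  then have "(norm x)\<^sup>2 = (norm p)\<^sup>2 + (norm (x - p))\<^sup>2"
    using norm_add_square[of p "x - p"] by simp
  then show ?thesis
    using norm_orthonormal_combination[OF assms, of "\<lambda>i. cinner x (u i)"] by (simp add: p_def)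
qed

text \<open>Gram-Schmidt for arbitrary sequences: normalizing with \<^const>\<open>sgn\<close> sends a vanishing
  residual to 0, so a vector that depends linearly on its predecessors becomes 0, and the vectors
  of the result are orthogonal and have norm 1 or 0.\<close>
fun orthonormalization :: "(nat \<Rightarrow> 'a::complex_hilbert_space) \<Rightarrow> nat \<Rightarrow> 'a" where
  "orthonormalization p k =
    sgn (p k - (\<Sum>j<k. cinner (p k) (orthonormalization p j) *\<^sub>C orthonormalization p j))"

declare orthonormalization.simps [simp del]

lemma orthonormalization_self:
  "cinner (orthonormalization p k) (orthonormalization p k) = (if orthonormalization p k = 0 then 0 else 1)"
proof -
  have "norm (orthonormalization p k) = 1" if "orthonormalization p k \<noteq> 0"
    using that by (subst (asm) orthonormalization.simps, subst orthonormalization.simps) (simp add: norm_sgn sgn_zero_iff)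
  then show ?thesis
    by (simp add: cinner_self)
qed

lemma orthonormalization_less:
  "j < k \<Longrightarrow> cinner (orthonormalization p k) (orthonormalization p j) = 0"
proof (induction k arbitrary: j rule: less_induct)
  case (less k)
  let ?u = "orthonormalization p"
  have "(\<Sum>i<k. cinner (p k) (?u i) * cinner (?u i) (?u j)) =
      (\<Sum>i<k. if i = j then cinner (p k) (?u j) else 0)"
  proof (rule sum.cong[OF refl])
    fix i
    assume "i \<in> {..<k}"
    then show "cinner (p k) (?u i) * cinner (?u i) (?u j) =
        (if i = j then cinner (p k) (?u j) else 0)"
      using less.IH[of i j] less.IH[of j i] less.prems cinner_eq_0_commute[of "?u i" "?u j"]
      by (cases i j rule: linorder_cases) (auto simp: orthonormalization_self)
  qed
  then have "cinner (p k - (\<Sum>i<k. cinner (p k) (?u i) *\<^sub>C ?u i)) (?u j) = 0"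
    using less.prems by (simp add: cinner_algebra)
  then show ?case
    by (subst orthonormalization.simps) (simp add: sgn_div_norm cinner_scaleR_left)
qed

lemma orthonormalization_orthogonal:
  "j \<noteq> k \<Longrightarrow> cinner (orthonormalization p k) (orthonormalization p j) = 0"
  using orthonormalization_less[of j k p] orthonormalization_less[of k j p]
  by (metis cinner_eq_0_commute linorder_neqE_nat)

lemma cspan_scaleR: "x \<in> cspan S \<Longrightarrow> r *\<^sub>R x \<in> cspan (S::'a::complex_hilbert_space set)"
  by (simp add: scaleR_scaleC complex_vector.span_scale)

lemma cspan_orthonormalization:
  "cspan (orthonormalization p ` {..<k}) = cspan (p ` {..<k})"
proof (induction k)
  case (Suc k)
  let ?u = "orthonormalization p"
  define s where "s = (\<Sum>j<k. cinner (p k) (?u j) *\<^sub>C ?u j)"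
  have s: "s \<in> cspan (?u ` {..<k})"
    unfolding s_def
    by (intro complex_vector.span_sum complex_vector.span_scale complex_vector.span_base) auto
  have u: "?u k = (1 / norm (p k - s)) *\<^sub>R (p k - s)"
    by (subst orthonormalization.simps) (simp add: s_def sgn_div_norm divide_inverse)
  have p: "p k = norm (p k - s) *\<^sub>R ?u k + s"
    using u by simp
  have sub1: "cspan (?u ` {..<k}) \<subseteq> cspan (?u ` {..<Suc k})"
    and sub2: "cspan (p ` {..<k}) \<subseteq> cspan (p ` {..<Suc k})"
    by (intro complex_vector.span_mono; auto)+
  have "?u k \<in> cspan (p ` {..<Suc k})"
    unfolding u using s sub2 Suc.IH
    by (intro cspan_scaleR complex_vector.span_diff) (auto intro: complex_vector.span_base)
  moreover have "p k \<in> cspan (?u ` {..<Suc k})"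
    by (subst p, use s sub1 in \<open>intro complex_vector.span_add cspan_scaleR\<close>)
      (auto intro: complex_vector.span_base)
  moreover have "?u ` {..<k} \<subseteq> cspan (p ` {..<Suc k})"
    using Suc.IH sub2 complex_vector.span_superset[of "?u ` {..<k}"] by auto
  moreover have "p ` {..<k} \<subseteq> cspan (?u ` {..<Suc k})"
    using Suc.IH sub1 complex_vector.span_superset[of "p ` {..<k}"] by auto
  ultimately show ?case
    by (intro complex_vector.span_eq[THEN iffD2]) (auto simp: lessThan_Suc)
qed simp

section \<open>Homogeneous linear systems\<close>

text \<open>Gaussian elimination of one equation at a time. All dimension counts below take this form: a
  family of vectors that outnumbers the linear conditions has a nontrivial combination which
  satisfies them all.\<close>
lemma homogeneous_system_nontrivial:
  fixes c :: "'i \<Rightarrow> 'e \<Rightarrow> 'k::field"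
  assumes "finite F" "finite I" "card F < card I"
  shows "\<exists>\<alpha>. (\<exists>i\<in>I. \<alpha> i \<noteq> 0) \<and> (\<forall>f\<in>F. (\<Sum>i\<in>I. \<alpha> i * c i f) = 0)"
  using assms
proof (induction F arbitrary: I c rule: finite_induct)
  case empty
  then obtain i where "i \<in> I"
    by (metis card.empty card_gt_0_iff equals0I)
  then show ?case
    by (intro exI[of _ "\<lambda>_. 1"]) auto
next
  case (insert f F)
  show ?case
  proof (cases "\<forall>i\<in>I. c i f = 0")
    case True
    have "card F < card I"
      using insert.prems insert.hyps by simp
    from insert.IH[OF insert.prems(1) this, of c] True show ?thesis
      by auto
  next
    case False
    then obtain p where p: "p \<in> I" "c p f \<noteq> 0"
      by auto
    define J where "J = I - {p}"
    have J: "finite J" "card F < card J"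
      using insert p by (auto simp: J_def)
    from insert.IH[OF this, of "\<lambda>i g. c i g - c i f / c p f * c p g"]
    obtain \<alpha> where \<alpha>: "\<exists>i\<in>J. \<alpha> i \<noteq> 0"
      "\<And>g. g \<in> F \<Longrightarrow> (\<Sum>i\<in>J. \<alpha> i * (c i g - c i f / c p f * c p g)) = 0"
      by auto
    define r where "r = - (\<Sum>i\<in>J. \<alpha> i * c i f) / c p f"
    define \<beta> where "\<beta> = \<alpha>(p := r)"
    have split: "(\<Sum>i\<in>I. \<beta> i * h i) = r * h p + (\<Sum>i\<in>J. \<alpha> i * h i)" for h
    proof -
      have "(\<Sum>i\<in>J. \<beta> i * h i) = (\<Sum>i\<in>J. \<alpha> i * h i)"
        by (intro sum.cong) (auto simp: \<beta>_def J_def)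
      then show ?thesis
        using insert.prems p by (simp add: sum.remove[of I p] J_def \<beta>_def)
    qed
    have "(\<Sum>i\<in>I. \<beta> i * c i g) = 0" if "g \<in> insert f F" for g
    proof (cases "g = f")
      case True
      then show ?thesis
        using p by (simp add: split r_def)
    next
      case False
      with that have "g \<in> F"
        by simp
      have "0 = (\<Sum>i\<in>J. \<alpha> i * c i g - \<alpha> i * c i f * (c p g / c p f))"
        using \<alpha>(2)[OF \<open>g \<in> F\<close>] by (simp add: algebra_simps)
      also have "\<dots> = (\<Sum>i\<in>J. \<alpha> i * c i g) - (\<Sum>i\<in>J. \<alpha> i * c i f) * (c p g / c p f)"
        by (simp only: sum_subtractf sum_distrib_right)
      finally show ?thesis
        by (simp add: split r_def)
    qed
    moreover have "\<exists>i\<in>I. \<beta> i \<noteq> 0"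
      using \<alpha>(1) by (auto simp: \<beta>_def J_def)
    ultimately show ?thesis
      by blast
  qed
qed

section \<open>Bounded operators\<close>

lemma bounded_clinear_simps:
  fixes T :: "'a::complex_hilbert_space \<Rightarrow> 'a"
  assumes "bounded_clinear T"
  shows "T (x + y) = T x + T y" "T (x - y) = T x - T y" "T (c *\<^sub>C x) = c *\<^sub>C T x"
    "T (r *\<^sub>R x) = r *\<^sub>R T x" "T 0 = 0" "T (sum f I) = (\<Sum>i\<in>I. T (f i))"
proof -
  interpret bounded_linear T
    using assms by (simp add: bounded_clinear_def)
  show "T (x + y) = T x + T y" "T (x - y) = T x - T y" "T (r *\<^sub>R x) = r *\<^sub>R T x" "T 0 = 0"
    "T (sum f I) = (\<Sum>i\<in>I. T (f i))"
    by (simp_all add: add diff scaleR zero sum)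
  show "T (c *\<^sub>C x) = c *\<^sub>C T x"
    using assms by (simp add: bounded_clinear_def)
qed

lemma bounded_clinear_bound:
  fixes T :: "'a::complex_hilbert_space \<Rightarrow> 'a"
  assumes "bounded_clinear T"
  obtains L where "L > 0" "\<And>x. norm (T x) \<le> L * norm x"
  using assms bounded_linear.pos_bounded[of T] by (auto simp: bounded_clinear_def mult.commute)

lemma bounded_clinearI:
  fixes T :: "'a::complex_hilbert_space \<Rightarrow> 'a"
  assumes "\<And>x y. T (x + y) = T x + T y" "\<And>c x. T (c *\<^sub>C x) = c *\<^sub>C T x" "\<And>x. norm (T x) \<le> norm x * K"
  shows "bounded_clinear T"
  unfolding bounded_clinear_def
  using assms by (auto intro!: bounded_linear_intro simp: scaleR_scaleC)

lemma bounded_clinear_shift: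
  fixes A :: "'a::complex_hilbert_space \<Rightarrow> 'a"
  assumes "bounded_clinear A"
  shows "bounded_clinear (\<lambda>x. A x - z *\<^sub>C x)"
proof -
  obtain L where L: "L > 0" "\<And>x. norm (A x) \<le> L * norm x"
    using bounded_clinear_bound[OF assms] by blast
  show ?thesis
  proof (rule bounded_clinearI[where K = "L + cmod z"])
    show "norm (A x - z *\<^sub>C x) \<le> norm x * (L + cmod z)" for x
      using norm_triangle_ineq4[of "A x" "z *\<^sub>C x"] L(2)[of x]
      by (simp add: norm_scaleC algebra_simps)
  qed (simp_all add: bounded_clinear_simps[OF assms] scaleC_add_right complex_vector.scale_right_diff_distrib
      scaleC_scaleC mult.commute)
qed

lemma self_adjoint_shift:
  "self_adjoint A \<Longrightarrow> self_adjoint (\<lambda>x. A x - of_real t *\<^sub>C x)"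
  by (simp add: self_adjoint_def cinner_algebra)

lemma bounded_clinear_uminus: "bounded_clinear A \<Longrightarrow> bounded_clinear (\<lambda>x. - A x)"
  unfolding bounded_clinear_def by (auto intro: bounded_linear_minus simp: complex_vector.scale_minus_right)

lemma self_adjoint_uminus: "self_adjoint A \<Longrightarrow> self_adjoint (\<lambda>x. - A x)"
  by (simp add: self_adjoint_def)

lemma Re_cinner_le: "\<bar>Re (cinner x (y::'a::complex_hilbert_space))\<bar> \<le> norm x * norm y"
  using cauchy_schwarz[of x y] abs_Re_le_cmod[of "cinner x y"] by linarith

text \<open>For a coercive \<open>C\<close> and small \<open>s > 0\<close> the map \<open>x \<mapsto> x - s (C x - y)\<close> is a contraction,
  and its fixed point solves \<open>C x = y\<close>.\<close>
lemma coercive_invertible: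
  fixes C :: "'a::complex_hilbert_space \<Rightarrow> 'a"
  assumes C: "bounded_clinear C" and "\<kappa> > 0" and coer: "\<And>x. \<kappa> * (norm x)\<^sup>2 \<le> Re (cinner (C x) x)"
  shows "\<exists>R. bounded_clinear R \<and> (\<forall>x. R (C x) = x) \<and> (\<forall>x. C (R x) = x)"
proof -
  obtain L0 where L0: "L0 > 0" "\<And>x. norm (C x) \<le> L0 * norm x"
    using bounded_clinear_bound[OF C] by blast
  define L where "L = max L0 \<kappa>"
  have L: "L \<ge> \<kappa>" "L > 0" "norm (C x) \<le> L * norm x" for x
    using L0(1) order_trans[OF L0(2)[of x] mult_right_mono[of L0 L "norm x"]] by (auto simp: L_def)
  have below: "\<kappa> * norm x \<le> norm (C x)" for x
  proof (cases "x = 0")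
    case False
    have "\<kappa> * norm x * norm x \<le> norm (C x) * norm x"
      using coer[of x] Re_cinner_le[of "C x" x] by (simp add: power2_eq_square)
    then show ?thesis
      using False by simp
  qed simp
  define s where "s = \<kappa> / L\<^sup>2"
  define q where "q = sqrt (1 - \<kappa>\<^sup>2 / L\<^sup>2)"
  have "\<kappa>\<^sup>2 / L\<^sup>2 \<le> 1" "\<kappa>\<^sup>2 / L\<^sup>2 > 0"
    using L \<open>\<kappa> > 0\<close> by (simp_all add: power_mono)
  then have q: "0 \<le> q" "q < 1" "q\<^sup>2 = 1 - \<kappa>\<^sup>2 / L\<^sup>2"
    by (simp_all add: q_def)
  have s: "s > 0"
    using L \<open>\<kappa> > 0\<close> by (simp add: s_def)
  have contr: "norm (x - s *\<^sub>R C x) \<le> q * norm x" for x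
  proof -
    have "(norm (x - s *\<^sub>R C x))\<^sup>2 = (norm x)\<^sup>2 - 2 * s * Re (cinner (C x) x) + s\<^sup>2 * (norm (C x))\<^sup>2"
      using norm_add_square[of "- (s *\<^sub>R C x)" x]
      by (simp add: cinner_scaleR_left power_mult_distrib)
    also have "\<dots> \<le> (norm x)\<^sup>2 - 2 * s * (\<kappa> * (norm x)\<^sup>2) + s\<^sup>2 * (L * norm x)\<^sup>2"
      using s L(3)[of x] coer[of x] by (intro add_mono diff_mono mult_left_mono power_mono) auto
    also have "\<dots> = (q * norm x)\<^sup>2"
      using L by (simp add: power_mult_distrib q(3) s_def) (simp add: field_simps power2_eq_square)
    finally show ?thesis
      using q by (simp add: power2_le_iff_abs_le)
  qed
  have "\<exists>x. C x = y" for y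
  proof -
    define g where "g = (\<lambda>x. x - s *\<^sub>R (C x - y))"
    have "dist (g x) (g x') \<le> q * dist x x'" for x x'
      using contr[of "x - x'"] by (simp add: dist_norm g_def bounded_clinear_simps[OF C] algebra_simps)
    then obtain x where "g x = x"
      using banach_fix_type[of q g] q by blast
    then show ?thesis
      using s by (auto simp: g_def)
  qed
  then obtain R where CR: "\<And>y. C (R y) = y"
    by metis
  have inj: "x = x'" if "C x = C x'" for x x'
    using below[of "x - x'"] that \<open>\<kappa> > 0\<close>
    by (simp add: bounded_clinear_simps[OF C] mult_le_0_iff)
  have "bounded_clinear R"
  proof (rule bounded_clinearI[where K = "1 / \<kappa>"])
    show "norm (R x) \<le> norm x * (1 / \<kappa>)" for x
      using below[of "R x"] \<open>\<kappa> > 0\<close> by (simp add: CR field_simps)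
  qed (rule inj, simp add: CR bounded_clinear_simps[OF C])+
  then show ?thesis
    using CR inj by blast
qed

lemma closed_cspan_insert:
  fixes Y :: "'a::complex_hilbert_space set"
  assumes Y: "complex_vector.subspace Y" "closed Y"
  shows "closed (cspan (insert v Y))"
proof (cases "v \<in> Y")
  case True
  then show ?thesis
    using Y by (simp add: insert_absorb complex_vector.span_eq_iff[THEN iffD2])
next
  case False
  have span_Y: "cspan Y = Y"
    using Y by simp
  obtain d where d: "d > 0" "\<And>y. y \<in> Y \<Longrightarrow> d \<le> dist v y"
    using False Y(2) by (metis closed_approachable dist_commute not_le)
  \<comment> \<open>the coefficient of \<open>v\<close> is a bounded functional, because \<open>v\<close> has positive distance to \<open>Y\<close>\<close>
  have coeff: "cmod k * d \<le> norm z" if "z - k *\<^sub>C v \<in> Y" for z k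
  proof (cases "k = 0")
    case False
    have "(- inverse k) *\<^sub>C (z - k *\<^sub>C v) \<in> Y"
      using that Y(1) by (rule complex_vector.subspace_scale[rotated])
    moreover have "(- inverse k) *\<^sub>C (z - k *\<^sub>C v) = v - inverse k *\<^sub>C z"
      using False by (simp add: complex_vector.scale_right_diff_distrib complex_vector.scale_minus_left)
    ultimately have "d \<le> dist v (v - inverse k *\<^sub>C z)"
      by (metis d(2))
    then have "d \<le> norm z / cmod k"
      by (simp add: dist_norm norm_scaleC norm_inverse divide_inverse mult.commute)
    then show ?thesis
      using False by (simp add: pos_le_divide_eq mult.commute)
  qed simp
  show ?thesis
    unfolding closed_sequential_limits
  proof (intro allI impI, elim conjE)
    fix z l
    assume z: "\<forall>n. z n \<in> cspan (insert v Y)" and l: "z \<longlonglongrightarrow> l"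
    obtain k where k: "\<And>n. z n - k n *\<^sub>C v \<in> Y"
      using z by (auto simp: complex_vector.span_breakdown_eq span_Y) metis
    have diff: "cmod (k m - k n) * d \<le> norm (z m - z n)" for m n
    proof (rule coeff)
      have "(z m - k m *\<^sub>C v) - (z n - k n *\<^sub>C v) \<in> Y"
        by (rule complex_vector.subspace_diff[OF Y(1) k k])
      then show "z m - z n - (k m - k n) *\<^sub>C v \<in> Y"
        by (simp add: complex_vector.scale_left_diff_distrib algebra_simps)
    qed
    have "Cauchy k"
    proof (rule metric_CauchyI)
      fix e :: real
      assume "e > 0"
      then obtain M where M: "\<And>m n. m \<ge> M \<Longrightarrow> n \<ge> M \<Longrightarrow> dist (z m) (z n) < e * d"
        using LIMSEQ_imp_Cauchy[OF l] d(1) metric_CauchyD[of z "e * d"] by auto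
      have "dist (k m) (k n) < e" if "m \<ge> M" "n \<ge> M" for m n
      proof -
        have "cmod (k m - k n) * d < e * d"
          using diff[of m n] M[OF that] by (simp add: dist_norm)
        then show ?thesis
          using d(1) by (simp add: dist_norm)
      qed
      then show "\<exists>M. \<forall>m\<ge>M. \<forall>n\<ge>M. dist (k m) (k n) < e"
        by blast
    qed
    then obtain c where c: "k \<longlonglongrightarrow> c"
      using Cauchy_convergent convergent_def by blast
    have "(\<lambda>n. k n *\<^sub>C v) \<longlonglongrightarrow> c *\<^sub>C v"
    proof -
      have "(\<lambda>n. cmod (k n - c) * norm v) \<longlonglongrightarrow> 0"
        using tendsto_mult_left_zero[OF tendsto_norm_zero[OF LIM_zero[OF c]], of "norm v"] .
      then have "(\<lambda>n. norm (k n *\<^sub>C v - c *\<^sub>C v)) \<longlonglongrightarrow> 0"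
        by (simp add: norm_scaleC flip: complex_vector.scale_left_diff_distrib)
      then show ?thesis
        by (rule LIM_zero_cancel[OF tendsto_norm_zero_cancel])
    qed
    then have "(\<lambda>n. z n - k n *\<^sub>C v) \<longlonglongrightarrow> l - c *\<^sub>C v"
      by (intro tendsto_diff l)
    then have "l - c *\<^sub>C v \<in> Y"
      by (rule closed_sequentially[OF Y(2) k])
    then show "l \<in> cspan (insert v Y)"
      by (auto simp: complex_vector.span_breakdown_eq span_Y)
  qed
qed

lemma closed_cspan_union_finite:
  fixes Y :: "'a::complex_hilbert_space set"
  assumes Y: "complex_vector.subspace Y" "closed Y" and "finite D"
  shows "closed (cspan (Y \<union> D))"
  using \<open>finite D\<close>
proof (induction D rule: finite_induct)
  case empty
  then show ?case
    using Y by (simp add: complex_vector.span_eq_iff[THEN iffD2])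
next
  case (insert d D)
  have "cspan (Y \<union> insert d D) = cspan (insert d (cspan (Y \<union> D)))"
    by (auto simp: complex_vector.span_breakdown_eq complex_vector.span_span)
  then show ?case
    using closed_cspan_insert[OF complex_vector.subspace_span insert.IH] by simp
qed

section \<open>Weyl's criterion\<close>

text \<open>Approximate null vectors exist in every subspace of finite codimension that is cut out by
  orthogonality relations; iterating this choice produces the orthonormal sequences of Weyl's
  criterion.\<close>
definition weyl_singular :: "('a::complex_hilbert_space \<Rightarrow> 'a) \<Rightarrow> bool"
  where "weyl_singular B \<longleftrightarrow>
    (\<forall>F \<eta>. finite F \<and> \<eta> > 0 \<longrightarrow> (\<exists>x. (\<forall>f\<in>F. cinner x f = 0) \<and> norm (B x) < \<eta> * norm x))"

text \<open>Let \<open>P\<close> be the orthogonal projection onto the span of \<open>F\<close>. For large \<open>c\<close> the operator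
  \<open>C = B\<^sup>2 + c P\<close> is coercive, hence invertible. From \<open>C x = c P x\<close> on the kernel of \<open>B\<close>, this
  kernel lies in the image of the span of \<open>F\<close> under the inverse of \<open>C\<close>; and \<open>x = C (C\<^sup>-\<^sup>1 x)\<close>
  shows that the ranges of \<open>B\<close> and \<open>P\<close> together span everything. The range of \<open>B\<close> is closed as
  the sum of a finite-dimensional space and the image of the orthogonal complement of \<open>F\<close>, on
  which \<open>B\<close> is bounded below.\<close>
lemma fredholm_if_bounded_below:
  fixes B :: "'a::complex_hilbert_space \<Rightarrow> 'a"
  assumes B: "bounded_clinear B" and sa: "self_adjoint B"
    and "finite F" "\<eta> > 0"
    and below: "\<And>x. (\<And>f. f \<in> F \<Longrightarrow> cinner x f = 0) \<Longrightarrow> \<eta> * norm x \<le> norm (B x)"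
  shows "fredholm B"
proof -
  note simps = bounded_clinear_simps[OF B]
  obtain L where L: "L > 0" "\<And>x. norm (B x) \<le> L * norm x"
    using bounded_clinear_bound[OF B] by blast
  obtain p and n :: nat where F: "F = p ` {..<n}"
    using \<open>finite F\<close> by (auto simp: finite_conv_nat_seg_image lessThan_def)
  define u where "u = orthonormalization p"
  define P where "P = (\<lambda>x. \<Sum>k<n. cinner x (u k) *\<^sub>C u k)"
  define U where "U = u ` {..<n}"
  have P_U: "P x \<in> cspan U" for x
    unfolding P_def U_def
    by (intro complex_vector.span_sum complex_vector.span_scale complex_vector.span_base) auto
  have cinner_P: "cinner (P x) (u j) = cinner x (u j)" if "j < n" for x j
  proof -
    have "(\<Sum>k<n. cinner x (u k) * cinner (u k) (u j)) = (\<Sum>k<n. if k = j then cinner x (u j) else 0)"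
      by (intro sum.cong)
        (auto simp: u_def orthonormalization_self orthonormalization_orthogonal)
    then show ?thesis
      using that by (simp add: P_def cinner_algebra)
  qed
  have residual_U: "cinner (x - P x) y = 0" if "y \<in> cspan U" for x y
    using that by (rule cinner_cspan_zero') (auto simp: U_def cinner_diff_left cinner_P)
  have span_U: "cspan U = cspan F"
    by (simp add: U_def F u_def cspan_orthonormalization)
  have residual: "cinner (x - P x) f = 0" if "f \<in> F" for x f
    using residual_U[of f] that by (simp add: span_U complex_vector.span_base)
  have Px: "cinner (P x) x = of_real ((norm (P x))\<^sup>2)" for x
  proof -
    have "cinner x (P x) = cinner (P x) (P x)"
      using residual_U[OF P_U[of x], of x] by (simp add: cinner_diff_left)
    then show ?thesis
      by (metis cinner_commute cinner_self complex_cnj_complex_of_real)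
  qed
  have pyth: "(norm x)\<^sup>2 = (norm (P x))\<^sup>2 + (norm (x - P x))\<^sup>2" for x
    using norm_add_square[of "x - P x" "P x"] residual_U[OF P_U[of x], of x] by simp
  have P_lin: "P (x + y) = P x + P y" "P (c *\<^sub>C x) = c *\<^sub>C P x" for x y c
    by (simp_all add: P_def cinner_algebra scaleC_add_left sum.distrib
        complex_vector.scale_sum_right scaleC_scaleC)
  have P_norm: "norm (P x) \<le> norm x" for x
    by (rule power2_le_imp_le) (simp_all add: pyth[of x])

  \<comment> \<open>\<open>L\<^sup>2\<close> compensates the loss in \<open>\<parallel>B x\<parallel> \<ge> \<eta> \<parallel>x - P x\<parallel> - L \<parallel>P x\<parallel>\<close>, and the remaining
    \<open>\<eta>\<^sup>2 / 2\<close> is the coercivity constant\<close>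
  define c where "c = L\<^sup>2 + \<eta>\<^sup>2 / 2"
  define C where "C = (\<lambda>x. B (B x) + of_real c *\<^sub>C P x)"
  have C: "bounded_clinear C"
  proof (rule bounded_clinearI[where K = "L * L + cmod (of_real c)"])
    show "norm (C x) \<le> norm x * (L * L + cmod (of_real c))" for x
    proof -
      have "norm (C x) \<le> norm (B (B x)) + cmod (of_real c) * norm (P x)"
        unfolding C_def by (metis norm_scaleC norm_triangle_ineq)
      also have "\<dots> \<le> L * (L * norm x) + cmod (of_real c) * norm x"
        using L P_norm by (intro add_mono mult_left_mono order_trans[OF L(2)]) auto
      finally show ?thesis
        by (simp add: algebra_simps)
    qed
  qed (simp_all add: C_def P_lin simps scaleC_add_right scaleC_scaleC mult.commute)
  have "\<eta>\<^sup>2 / 2 * (norm x)\<^sup>2 \<le> Re (cinner (C x) x)" for x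
  proof -
    have "\<eta> * norm (x - P x) \<le> norm (B (x - P x))"
      by (intro below residual)
    also have "\<dots> \<le> norm (B x) + L * norm (P x)"
      using norm_triangle_ineq4[of "B x" "B (P x)"] L(2)[of "P x"] by (simp add: simps)
    finally have "(\<eta> * norm (x - P x))\<^sup>2 \<le> (norm (B x) + L * norm (P x))\<^sup>2"
      using \<open>\<eta> > 0\<close> by (intro power_mono) auto
    also have "\<dots> \<le> 2 * (norm (B x))\<^sup>2 + 2 * (L * norm (P x))\<^sup>2"
      using sum_squares_bound[of "norm (B x)" "L * norm (P x)"] by (simp add: power2_sum)
    finally have "\<eta>\<^sup>2 * (norm (x - P x))\<^sup>2 \<le> 2 * (norm (B x))\<^sup>2 + 2 * (L\<^sup>2 * (norm (P x))\<^sup>2)"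
      by (simp add: power_mult_distrib)
    moreover have "Re (cinner (C x) x) = (norm (B x))\<^sup>2 + c * (norm (P x))\<^sup>2"
    proof -
      have "cinner (B (B x)) x = cinner (B x) (B x)"
        using sa by (simp add: self_adjoint_def)
      then show ?thesis
        by (simp add: C_def cinner_algebra Px cinner_self)
    qed
    ultimately show ?thesis
      unfolding pyth[of x] by (simp add: c_def algebra_simps)
  qed
  then obtain R where R: "bounded_clinear R" "\<And>x. R (C x) = x" "\<And>x. C (R x) = x"
    using coercive_invertible[OF C, of "\<eta>\<^sup>2 / 2"] \<open>\<eta> > 0\<close> by auto

  have "{x. B x = 0} \<subseteq> cspan (R ` U)"
  proof
    fix x
    assume "x \<in> {x. B x = 0}"
    then have "x = R (of_real c *\<^sub>C P x)"
      using R(2)[of x] by (simp add: C_def simps)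
    moreover have "R y \<in> cspan (R ` U)" if "y \<in> cspan U" for y
      using that
    proof (induction rule: complex_vector.span_induct_alt)
      case base
      then show ?case
        by (simp add: bounded_clinear_simps[OF R(1)] complex_vector.span_zero)
    next
      case (step c x y)
      then show ?case
        by (simp add: bounded_clinear_simps[OF R(1)] complex_vector.span_add
            complex_vector.span_scale complex_vector.span_base)
    qed
    ultimately show "x \<in> cspan (R ` U)"
      using P_U[of x] complex_vector.span_scale[of "P x" U "of_real c"] by metis
  qed
  moreover have "cspan (range B \<union> U) = UNIV"
  proof (rule UNIV_eq_I[symmetric])
    fix x
    have "x = B (B (R x)) + of_real c *\<^sub>C P (R x)"
      using R(3)[of x] by (simp add: C_def)
    moreover have "B (B (R x)) \<in> cspan (range B \<union> U)"
      by (intro complex_vector.span_base) auto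
    moreover have "of_real c *\<^sub>C P (R x) \<in> cspan (range B \<union> U)"
      using P_U complex_vector.span_mono[of U "range B \<union> U"]
      by (intro complex_vector.span_scale) auto
    ultimately show "x \<in> cspan (range B \<union> U)"
      by (metis complex_vector.span_add)
  qed
  moreover have "closed (range B)"
  proof -
    define Z where "Z = {x. \<forall>f\<in>F. cinner x f = 0}"
    have Z: "complex_vector.subspace Z"
      by (auto simp: Z_def complex_vector.subspace_def cinner_algebra)
    have "Z = (\<Inter>f\<in>F. {x. cinner x f = 0})"
      by (auto simp: Z_def)
    moreover have "closed {x. cinner x f = 0}" for f
      by (intro closed_Collect_eq linear_continuous_on bounded_linear_cinner_left continuous_on_const)
    ultimately have "closed Z"
      by auto
    have "complete (B ` Z)"
    proof (rule complete_isometric_image)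
      show "Real_Vector_Spaces.subspace Z"
        using Z by (auto simp: real_vector.subspace_def complex_vector.subspace_def scaleR_scaleC)
      show "complete Z"
        using \<open>closed Z\<close> by (simp add: complete_eq_closed)
      show "\<forall>x\<in>Z. \<eta> * norm x \<le> norm (B x)"
        using below by (auto simp: Z_def)
    qed (use B \<open>\<eta> > 0\<close> in \<open>auto simp: bounded_clinear_def\<close>)
    then have "closed (B ` Z)"
      by (rule complete_imp_closed)
    moreover have sub: "complex_vector.subspace (B ` Z)"
      unfolding complex_vector.subspace_def
    proof (intro conjI ballI allI)
      show "0 \<in> B ` Z"
        using Z simps(5) by (metis complex_vector.subspace_0 imageI)
    qed (use Z in \<open>auto simp: simps(1,3)[symmetric] intro: complex_vector.subspace_add complex_vector.subspace_scale\<close>)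
    ultimately have "closed (cspan (B ` Z \<union> B ` U))"
      by (intro closed_cspan_union_finite) (auto simp: U_def)
    moreover have "cspan (B ` Z \<union> B ` U) = range B"
    proof
      have "complex_vector.subspace (range B)"
        unfolding complex_vector.subspace_def
        by (auto simp: simps(1,3)[symmetric]) (metis simps(5) rangeI)
      then show "cspan (B ` Z \<union> B ` U) \<subseteq> range B"
        by (intro complex_vector.span_minimal) auto
      show "range B \<subseteq> cspan (B ` Z \<union> B ` U)"
      proof
        fix y
        assume "y \<in> range B"
        then obtain x where "y = B x"
          by blast
        then have "y = B (x - P x) + B (P x)"
          by (simp add: simps)
        moreover have "B (x - P x) \<in> B ` Z"
          using residual by (auto simp: Z_def)
        moreover have "B (P x) \<in> cspan (B ` Z \<union> B ` U)"
          unfolding P_def simps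
          by (intro complex_vector.span_sum complex_vector.span_scale complex_vector.span_base)
            (auto simp: U_def)
        ultimately show "y \<in> cspan (B ` Z \<union> B ` U)"
          by (metis UnI1 complex_vector.span_add complex_vector.span_base)
      qed
    qed
    ultimately show ?thesis
      by simp
  qed
  moreover have "finite U"
    by (simp add: U_def)
  ultimately show ?thesis
    unfolding fredholm_def using B by blast
qed

lemma orthonormal_sequence:
  fixes Q :: "nat \<Rightarrow> 'a::complex_hilbert_space \<Rightarrow> bool"
  assumes "\<And>F i. finite F \<Longrightarrow> \<exists>x. norm x = 1 \<and> Q i x \<and> (\<forall>f\<in>F. cinner x f = 0)"
  shows "\<exists>x. orthonormal_on UNIV x \<and> (\<forall>i. Q i (x i))"
proof -
  have "\<exists>x. \<forall>i::nat. norm (x i) = 1 \<and> Q i (x i) \<and> (\<forall>j<i. cinner (x i) (x j) = 0)"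
  proof (rule dependent_wellorder_choice)
    fix i and f :: "nat \<Rightarrow> 'a"
    show "\<exists>r. norm r = 1 \<and> Q i r \<and> (\<forall>j<i. cinner r (f j) = 0)"
      using assms[of "f ` {..<i}" i] by auto
  qed auto
  then obtain x :: "nat \<Rightarrow> 'a" where x: "\<And>i. norm (x i) = 1" "\<And>i. Q i (x i)"
    "\<And>i j. j < i \<Longrightarrow> cinner (x i) (x j) = 0"
    by blast
  have "cinner (x i) (x j) = (if i = j then 1 else 0)" for i j
    using x(3)[of i j] x(3)[of j i] cinner_eq_0_commute[of "x i" "x j"]
    by (cases i j rule: linorder_cases) (auto simp: cinner_self x(1))
  then show ?thesis
    using x(2) by (intro exI[of _ x]) (simp add: orthonormal_on_def)
qed

lemma orthonormal_on_subset: "orthonormal_on J u \<Longrightarrow> I \<subseteq> J \<Longrightarrow> orthonormal_on I u"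
  unfolding orthonormal_on_def by blast

lemma normalize_cinner:
  assumes "x \<noteq> (0::'a::complex_hilbert_space)"
  shows "norm ((1 / norm x) *\<^sub>R x) = 1"
    and "cinner x f = 0 \<Longrightarrow> cinner ((1 / norm x) *\<^sub>R x) f = 0"
  using assms by (simp_all add: cinner_scaleR_left)

lemma weyl_singular_sequence:
  assumes B: "bounded_clinear B" and "weyl_singular B" and "\<And>i. \<eta> i > (0::real)"
  shows "\<exists>x. orthonormal_on UNIV x \<and> (\<forall>i. norm (B (x i)) < \<eta> i)"
proof (rule orthonormal_sequence)
  fix F :: "'a set" and i
  assume "finite F"
  with assms(2,3) have "\<exists>x. (\<forall>f\<in>F. cinner x f = 0) \<and> norm (B x) < \<eta> i * norm x"
    by (simp add: weyl_singular_def)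
  then obtain x where x: "\<forall>f\<in>F. cinner x f = 0" "norm (B x) < \<eta> i * norm x"
    by blast
  have "x \<noteq> 0"
    using x(2) by (auto simp: bounded_clinear_simps[OF B])
  then show "\<exists>x. norm x = 1 \<and> norm (B x) < \<eta> i \<and> (\<forall>f\<in>F. cinner x f = 0)"
    using x normalize_cinner[of x]
    by (intro exI[of _ "(1 / norm x) *\<^sub>R x"]) (auto simp: bounded_clinear_simps[OF B] field_simps)
qed

lemma small_on_combination:
  assumes x: "orthonormal_on I x" "finite I"
    and small: "\<And>i. i \<in> I \<Longrightarrow> norm (z i) \<le> \<eta>"
  shows "norm (\<Sum>i\<in>I. c i *\<^sub>C z i) \<le> of_nat (card I) * \<eta> * norm (\<Sum>i\<in>I. c i *\<^sub>C x i)"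
proof -
  have "norm (c i *\<^sub>C z i) \<le> norm (\<Sum>i\<in>I. c i *\<^sub>C x i) * \<eta>" if "i \<in> I" for i
    unfolding norm_scaleC using coefficient_le_norm[OF x that, of c] small[OF that]
    by (intro mult_mono) auto
  then show ?thesis
    using sum_norm_bound[of I "\<lambda>i. c i *\<^sub>C z i" "norm (\<Sum>i\<in>I. c i *\<^sub>C x i) * \<eta>"]
    by (simp add: mult_ac)
qed

text \<open>Membership in the range of \<open>B\<close> and orthogonality to \<open>F\<close> impose finitely many linear conditions
  on the coefficients of a combination; with more vectors of a Weyl sequence than conditions, some
  nonzero combination satisfies them.\<close>
lemma weyl_singular_in_range:
  fixes B :: "'a::complex_hilbert_space \<Rightarrow> 'a"
  assumes B: "bounded_clinear B" and "weyl_singular B"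
    and D: "finite D" "cspan (range B \<union> D) = UNIV" and F: "finite F" and "\<eta> > 0"
  shows "\<exists>x. norm x = 1 \<and> x \<in> range B \<and> norm (B x) < \<eta> \<and> (\<forall>f\<in>F. cinner x f = 0)"
proof -
  note simps = bounded_clinear_simps[OF B]
  have sub: "complex_vector.subspace (range B)"
    unfolding complex_vector.subspace_def
    by (auto simp: simps(1,3)[symmetric]) (metis simps(5) rangeI)
  have decomp: "\<exists>c. y - (\<Sum>d\<in>D. c d *\<^sub>C d) \<in> range B" for y
  proof -
    have "y \<in> cspan (range B \<union> D)"
      by (simp add: D)
    then obtain r s where "r \<in> range B" "s \<in> cspan D" "y = r + s"
      using sub by (auto simp: complex_vector.span_Un complex_vector.span_eq_iff[THEN iffD2])
    moreover obtain c where "s = (\<Sum>d\<in>D. c d *\<^sub>C d)"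
      using \<open>s \<in> cspan D\<close> complex_vector.span_finite[OF D(1)] by auto
    ultimately show ?thesis
      by (intro exI[of _ c]) simp
  qed
  define I where "I = {..<card D + card F + 1}"
  define \<epsilon> where "\<epsilon> = \<eta> / (2 * card I)"
  have "\<epsilon> > 0"
    using \<open>\<eta> > 0\<close> by (simp add: \<epsilon>_def I_def)
  then obtain x where x: "orthonormal_on UNIV x" "\<And>i. norm (B (x i)) < \<epsilon>"
    using weyl_singular_sequence[OF assms(1,2), of "\<lambda>_. \<epsilon>"] by blast
  then have xI: "orthonormal_on I x" "finite I"
    by (auto simp: I_def intro: orthonormal_on_subset)
  have "\<forall>i. \<exists>c. x i - (\<Sum>d\<in>D. c d *\<^sub>C d) \<in> range B"
    using decomp by blast
  from choice[OF this] obtain c where c: "\<And>i. x i - (\<Sum>d\<in>D. c i d *\<^sub>C d) \<in> range B"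
    by blast
  define G where "G = Inl ` D \<union> Inr ` F"
  have "finite G" "card G < card I"
    using D F by (auto simp: G_def I_def card_Plus[unfolded Plus_def])
  with xI(2) obtain \<alpha> where \<alpha>: "\<exists>i\<in>I. \<alpha> i \<noteq> 0"
    "\<And>g. g \<in> G \<Longrightarrow> (\<Sum>i\<in>I. \<alpha> i * case_sum (\<lambda>d. c i d) (\<lambda>f. cinner (x i) f) g) = 0"
    using homogeneous_system_nontrivial[of G I "\<lambda>i. case_sum (\<lambda>d. c i d) (\<lambda>f. cinner (x i) f)"]
    by auto
  define v where "v = (\<Sum>i\<in>I. \<alpha> i *\<^sub>C x i)"
  have "v \<noteq> 0"
    using \<alpha>(1) coefficient_le_norm[OF xI, of _ \<alpha>] by (force simp: v_def)
  have orth: "cinner v f = 0" if "f \<in> F" for f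
    using \<alpha>(2)[of "Inr f"] that by (simp add: v_def cinner_algebra G_def)
  have "v \<in> range B"
  proof -
    have "(\<Sum>i\<in>I. \<alpha> i *\<^sub>C (\<Sum>d\<in>D. c i d *\<^sub>C d)) = (\<Sum>d\<in>D. (\<Sum>i\<in>I. \<alpha> i * c i d) *\<^sub>C d)"
      by (simp add: complex_vector.scale_sum_right complex_vector.scale_sum_left scaleC_scaleC)
        (rule sum.swap)
    also have "\<dots> = 0"
      using \<alpha>(2)[of "Inl _"] by (intro sum.neutral) (simp add: G_def)
    finally have "v = (\<Sum>i\<in>I. \<alpha> i *\<^sub>C (x i - (\<Sum>d\<in>D. c i d *\<^sub>C d)))"
      by (simp add: v_def complex_vector.scale_right_diff_distrib sum_subtractf)
    also have "\<dots> \<in> range B"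
      using c sub by (intro complex_vector.subspace_sum complex_vector.subspace_scale)
    finally show ?thesis .
  qed
  have "norm (B v) \<le> card I * \<epsilon> * norm v"
    unfolding v_def simps using small_on_combination[OF xI, of "\<lambda>i. B (x i)" \<epsilon>] x(2)
    by (simp add: less_imp_le)
  also have "card I * \<epsilon> = \<eta> / 2"
  proof -
    have "card I \<noteq> 0"
      by (simp add: I_def)
    then show ?thesis
      by (simp add: \<epsilon>_def)
  qed
  also have "\<eta> / 2 * norm v < \<eta> * norm v"
    using \<open>\<eta> > 0\<close> \<open>v \<noteq> 0\<close> by simp
  finally have "norm (B v) < \<eta> * norm v" .
  moreover have "(1 / norm v) *\<^sub>R v \<in> range B"
    using complex_vector.subspace_scale[OF sub \<open>v \<in> range B\<close>] by (simp add: scaleR_scaleC)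
  ultimately show ?thesis
    using \<open>v \<noteq> 0\<close> orth normalize_cinner[of v]
    by (intro exI[of _ "(1 / norm v) *\<^sub>R v"]) (auto simp: simps field_simps)
qed

text \<open>Take orthonormal \<open>x\<^sub>i = B w\<^sub>i\<close> with \<open>\<parallel>B x\<^sub>i\<parallel> < 4\<^sup>-\<^sup>i\<close>. The series of the \<open>2\<^sup>i B x\<^sub>i\<close> converges, and by
  closedness its sum is some \<open>B z\<close>. Pairing \<open>B z\<close> with \<open>w\<^sub>i\<close> and moving \<open>B\<close> to the other side gives
  \<open>\<langle>z, x\<^sub>i\<rangle> = 2\<^sup>i\<close>, although \<open>z\<close> has bounded coordinates. That the \<open>x\<^sub>i\<close> lie in the range is what
  makes their coordinates visible from \<open>B z\<close>.\<close>
lemma not_weyl_singular_if_fredholm: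
  fixes B :: "'a::complex_hilbert_space \<Rightarrow> 'a"
  assumes sa: "self_adjoint B" and fred: "fredholm B"
  shows "\<not> weyl_singular B"
proof
  assume sing: "weyl_singular B"
  from fred have B: "bounded_clinear B" and closed: "closed (range B)"
    by (auto simp: fredholm_def)
  note simps = bounded_clinear_simps[OF B]
  obtain D where D: "finite D" "cspan (range B \<union> D) = UNIV"
    using fred by (auto simp: fredholm_def)
  have "\<exists>x. orthonormal_on UNIV x \<and> (\<forall>i. x i \<in> range B \<and> norm (B (x i)) < (1 / 4) ^ i)"
  proof (rule orthonormal_sequence)
    fix F :: "'a set" and i :: nat
    assume "finite F"
    from weyl_singular_in_range[OF B sing D this, of "(1 / 4) ^ i"]
    show "\<exists>x. norm x = 1 \<and> (x \<in> range B \<and> norm (B x) < (1 / 4) ^ i) \<and> (\<forall>f\<in>F. cinner x f = 0)"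
      by auto
  qed
  then obtain x where x: "orthonormal_on UNIV x" "\<And>i. x i \<in> range B"
    "\<And>i. norm (B (x i)) < (1 / 4) ^ i"
    by blast
  from x(2) have "\<forall>i. \<exists>w. x i = B w"
    by auto
  from choice[OF this] obtain w where w: "\<And>i. x i = B (w i)"
    by blast
  define s where "s = (\<lambda>n. \<Sum>j<n. of_real (2 ^ j) *\<^sub>C x j)"
  have "summable (\<lambda>j. B (of_real (2 ^ j) *\<^sub>C x j))"
  proof (rule summable_comparison_test')
    show "summable (\<lambda>j. (1 / 2 :: real) ^ j)"
      by (intro summable_geometric) simp
    show "norm (B (of_real (2 ^ j) *\<^sub>C x j)) \<le> (1 / 2) ^ j" if "j \<ge> 0" for j
    proof -
      have "norm (B (of_real (2 ^ j) *\<^sub>C x j)) = 2 ^ j * norm (B (x j))"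
        by (simp add: simps norm_scaleC norm_power)
      also have "\<dots> \<le> 2 ^ j * (1 / 4) ^ j"
        using x(3)[of j] by (intro mult_left_mono) auto
      also have "\<dots> = (1 / 2) ^ j"
        by (simp flip: power_mult_distrib)
      finally show ?thesis .
    qed
  qed
  then obtain y where "(\<lambda>n. \<Sum>j<n. B (of_real (2 ^ j) *\<^sub>C x j)) \<longlonglongrightarrow> y"
    unfolding summable_def sums_def by blast
  then have y: "(\<lambda>n. B (s n)) \<longlonglongrightarrow> y"
    by (simp add: s_def simps)
  then have "y \<in> range B"
    using closed by (rule closed_sequentially[rotated 2]) simp
  then obtain z where z: "y = B z"
    by blast
  have z_coeff: "cinner z (x i) = 2 ^ i" for i
  proof -
    have "(\<lambda>n. cinner (B (s n)) (w i)) \<longlonglongrightarrow> cinner (B z) (w i)"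
      using bounded_linear.tendsto[OF bounded_linear_cinner_left y] z by simp
    then have "(\<lambda>n. cinner (s n) (x i)) \<longlonglongrightarrow> cinner z (x i)"
      using sa by (simp add: self_adjoint_def w)
    moreover have "eventually (\<lambda>n. cinner (s n) (x i) = 2 ^ i) sequentially"
      using eventually_gt_at_top[of i]
    proof eventually_elim
      case (elim n)
      then show ?case
        using cinner_orthonormal_combination[OF orthonormal_on_subset[OF x(1)], of "{..<n}" i
            "\<lambda>j. of_real (2 ^ j)"] by (simp add: s_def)
    qed
    then have "(\<lambda>n. cinner (s n) (x i)) \<longlonglongrightarrow> 2 ^ i"
      by (rule tendsto_eventually)
    ultimately show ?thesis
      by (rule LIMSEQ_unique)
  qed
  have "2 ^ i \<le> norm z" for i
  proof -
    have "(norm (x i))\<^sup>2 = 1"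
      using x(1) by (simp add: norm_square_cinner orthonormal_on_def)
    then have "norm (x i) = 1"
      using norm_ge_zero[of "x i"] by (auto simp: power2_eq_1_iff)
    then show ?thesis
      using cauchy_schwarz[of z "x i"] by (simp add: z_coeff norm_power)
  qed
  moreover obtain i where "norm z < 2 ^ i"
    using real_arch_pow[of 2 "norm z"] by auto
  ultimately show False
    by (metis not_le)
qed

theorem fredholm_iff_not_weyl_singular:
  fixes B :: "'a::complex_hilbert_space \<Rightarrow> 'a"
  assumes "bounded_clinear B" "self_adjoint B"
  shows "fredholm B \<longleftrightarrow> \<not> weyl_singular B"
proof
  assume "\<not> weyl_singular B"
  then obtain F \<eta> where F: "finite F" "\<eta> > 0"
    "\<nexists>x. (\<forall>f\<in>F. cinner x f = 0) \<and> norm (B x) < \<eta> * norm x"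
    by (auto simp: weyl_singular_def)
  show "fredholm B"
  proof (rule fredholm_if_bounded_below[OF assms F(1,2)])
    show "\<eta> * norm x \<le> norm (B x)" if "\<And>f. f \<in> F \<Longrightarrow> cinner x f = 0" for x
      using F(3) that by (meson not_le)
  qed
qed (rule not_weyl_singular_if_fredholm[OF assms(2)])

section \<open>The spectrum and the quadratic form\<close>

lemma essential_spectrum_subset:
  assumes "bounded_clinear A"
  shows "essential_spectrum A \<subseteq> op_spectrum A"
proof
  fix z
  assume z: "z \<in> essential_spectrum A"
  let ?B = "\<lambda>x. A x - z *\<^sub>C x"
  show "z \<in> op_spectrum A"
  proof (rule ccontr)
    assume "z \<notin> op_spectrum A"
    then obtain R where R: "bounded_clinear R" "\<And>x. R (?B x) = x" "\<And>x. ?B (R x) = x"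
      by (auto simp: op_spectrum_def)
    have "range ?B = UNIV"
      by (rule surjI) (rule R(3))
    moreover have "{x. ?B x = 0} \<subseteq> cspan {}"
    proof
      fix x
      assume "x \<in> {x. ?B x = 0}"
      then have "R 0 = x"
        using R(2)[of x] by simp
      then show "x \<in> cspan {}"
        by (simp add: bounded_clinear_simps(5)[OF R(1)])
    qed
    ultimately have "fredholm ?B"
      unfolding fredholm_def using bounded_clinear_shift[OF assms, of z]
      by (auto intro!: exI[of _ "{}"] complex_vector.span_UNIV)
    with z show False
      by (simp add: essential_spectrum_def)
  qed
qed

text \<open>Positivity of the form at \<open>x - (1 / L) D x\<close>, a vector that is again orthogonal to \<open>F\<close>. Where
  \<open>D\<close> is nonnegative, the inequality turns lower bounds for \<open>\<parallel>D x\<parallel>\<close> into lower bounds for the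
  form.\<close>
lemma norm_square_le_form:
  fixes D :: "'a::complex_hilbert_space \<Rightarrow> 'a"
  assumes D: "bounded_clinear D" and sa: "self_adjoint D"
    and L: "L > 0" "\<And>x. norm (D x) \<le> L * norm x"
    and pos: "\<And>x. \<forall>f\<in>F. cinner x f = 0 \<Longrightarrow> 0 \<le> Re (cinner (D x) x)"
    and x: "\<forall>f\<in>F. cinner x f = 0" "\<forall>f\<in>F. cinner (D x) f = 0"
  shows "(norm (D x))\<^sup>2 \<le> L * Re (cinner (D x) x)"
proof -
  let ?y = "x - (1 / L) *\<^sub>R D x"
  have sym: "cinner (D (D x)) x = cinner (D x) (D x)"
    using sa by (simp add: self_adjoint_def)
  have "0 \<le> Re (cinner (D ?y) ?y)"
    using x by (intro pos) (simp add: cinner_algebra)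
  also have "Re (cinner (D ?y) ?y) =
      Re (cinner (D x) x) - 2 / L * (norm (D x))\<^sup>2 + (1 / L)\<^sup>2 * Re (cinner (D (D x)) (D x))"
    unfolding norm_square_cinner
    by (simp add: bounded_clinear_simps[OF D] cinner_algebra sym diff_divide_distrib power2_eq_square
        del: of_real_divide)
  also have "Re (cinner (D (D x)) (D x)) \<le> L * (norm (D x))\<^sup>2"
    using Re_cinner_le[of "D (D x)" "D x"] mult_right_mono[OF L(2)[of "D x"], of "norm (D x)"]
    by (simp add: power2_eq_square)
  then have "(1 / L)\<^sup>2 * Re (cinner (D (D x)) (D x)) \<le> (1 / L)\<^sup>2 * (L * (norm (D x))\<^sup>2)"
    by (rule mult_left_mono) simp
  also have "(1 / L)\<^sup>2 * (L * (norm (D x))\<^sup>2) = 1 / L * (norm (D x))\<^sup>2"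
    using L(1) by (simp add: power2_eq_square)
  finally have "1 / L * (norm (D x))\<^sup>2 \<le> Re (cinner (D x) x)"
    by simp
  then show ?thesis
    using L(1) by (simp add: field_simps)
qed

text \<open>For \<open>t < \<mu>\<close> the operator \<open>A - t\<close> is coercive.\<close>
lemma spectrum_ge_form_bound:
  assumes A: "bounded_clinear A"
    and lower: "\<And>x. \<mu> * (norm x)\<^sup>2 \<le> Re (cinner (A x) x)"
    and t: "t \<in> real_points (op_spectrum A)"
  shows "\<mu> \<le> t"
proof (rule ccontr)
  assume "\<not> \<mu> \<le> t"
  then have "(\<mu> - t) * (norm x)\<^sup>2 \<le> Re (cinner (A x - of_real t *\<^sub>C x) x)" for x
    using lower[of x] by (simp add: cinner_algebra cinner_self algebra_simps flip: of_real_power)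
  from coercive_invertible[OF bounded_clinear_shift[OF A] _ this] \<open>\<not> \<mu> \<le> t\<close>
  have "of_real t \<notin> op_spectrum A"
    by (auto simp: op_spectrum_def)
  with t show False
    by (simp add: real_points_def)
qed

text \<open>Let \<open>\<mu>\<close> be the infimum of the form on the unit sphere. If \<open>A - \<mu>\<close> were invertible, it would be
  bounded below in norm; being nonnegative, it would then have a form that is bounded below by a
  positive constant on the unit sphere, and \<open>\<mu>\<close> would not be the infimum.\<close>
lemma form_minimum_in_spectrum:
  fixes A :: "'a::complex_hilbert_space \<Rightarrow> 'a"
  assumes A: "bounded_clinear A" and sa: "self_adjoint A" and nontrivial: "\<exists>x::'a. x \<noteq> 0"
  shows "\<exists>\<mu>\<in>real_points (op_spectrum A). \<forall>x. \<mu> * (norm x)\<^sup>2 \<le> Re (cinner (A x) x)"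
proof -
  obtain L where L: "L > 0" "\<And>x. norm (A x) \<le> L * norm x"
    using bounded_clinear_bound[OF A] by blast
  define W where "W = {Re (cinner (A x) x) | x. norm x = 1}"
  have "W \<noteq> {}"
    using nontrivial normalize_cinner(1) unfolding W_def by blast
  have "- L \<le> w" if "w \<in> W" for w
  proof -
    obtain x where x: "norm x = 1" "w = Re (cinner (A x) x)"
      using \<open>w \<in> W\<close> by (auto simp: W_def)
    then show ?thesis
      using Re_cinner_le[of "A x" x] L(2)[of x] by simp
  qed
  then have bdd: "bdd_below W"
    by (rule bdd_belowI)
  define \<mu> where "\<mu> = Inf W"
  have lower: "\<mu> * (norm x)\<^sup>2 \<le> Re (cinner (A x) x)" for x
  proof (cases "x = 0")
    case False
    let ?y = "(1 / norm x) *\<^sub>R x"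
    have "\<mu> \<le> Re (cinner (A ?y) ?y)"
      unfolding \<mu>_def using normalize_cinner(1)[OF False] bdd
      by (intro cInf_lower) (auto simp: W_def)
    also have "\<dots> = Re (cinner (A x) x) / (norm x)\<^sup>2"
      by (simp add: bounded_clinear_simps[OF A] cinner_algebra power2_eq_square)
    finally show ?thesis
      using False by (simp add: field_simps)
  qed (simp add: bounded_clinear_simps[OF A])
  have "\<mu> \<in> real_points (op_spectrum A)"
  proof (rule ccontr)
    let ?D = "\<lambda>x. A x - of_real \<mu> *\<^sub>C x"
    assume "\<mu> \<notin> real_points (op_spectrum A)"
    then obtain R where R: "bounded_clinear R" "\<And>x. R (?D x) = x"
      by (auto simp: real_points_def op_spectrum_def)
    obtain K where K: "K > 0" "\<And>x. norm (R x) \<le> K * norm x"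
      using bounded_clinear_bound[OF R(1)] by blast
    have D: "bounded_clinear ?D" "self_adjoint ?D"
      by (intro bounded_clinear_shift A self_adjoint_shift sa)+
    obtain M where M: "M > 0" "\<And>x. norm (?D x) \<le> M * norm x"
      using bounded_clinear_bound[OF D(1)] by blast
    have form: "Re (cinner (?D x) x) = Re (cinner (A x) x) - \<mu> * (norm x)\<^sup>2" for x
      by (simp add: cinner_algebra cinner_self flip: of_real_power)
    have "\<mu> + 1 / (M * K\<^sup>2) \<le> w" if "w \<in> W" for w
    proof -
      obtain x where x: "norm x = 1" "w = Re (cinner (A x) x)"
        using \<open>w \<in> W\<close> by (auto simp: W_def)
      have "(norm (?D x))\<^sup>2 \<le> M * Re (cinner (?D x) x)"
        using norm_square_le_form[OF D M, of "{}" x] lower by (simp add: form)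
      also have "\<dots> = M * (w - \<mu>)"
        using x form[of x] by simp
      finally have "(norm (?D x))\<^sup>2 \<le> M * (w - \<mu>)" .
      moreover have "1 \<le> K * norm (?D x)"
        using K(2)[of "?D x"] R(2)[of x] x(1) by simp
      then have "1 \<le> K\<^sup>2 * (norm (?D x))\<^sup>2"
        using power_mono[of 1 "K * norm (?D x)" 2] by (simp add: power_mult_distrib)
      ultimately have "1 \<le> K\<^sup>2 * (M * (w - \<mu>))"
        using K(1) by (meson mult_left_mono order_trans zero_le_power2)
      then show ?thesis
        using K M by (simp add: field_simps)
    qed
    then have "\<mu> + 1 / (M * K\<^sup>2) \<le> \<mu>"
      unfolding \<mu>_def using \<open>W \<noteq> {}\<close> by (intro cInf_greatest)
    then show False
      using K M by (simp add: field_simps)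
  qed
  with lower show ?thesis
    by blast
qed

lemma op_spectrum_uminus_subset:
  fixes A :: "'a::complex_hilbert_space \<Rightarrow> 'a"
  assumes A: "bounded_clinear A" and z: "z \<in> op_spectrum (\<lambda>x. - A x)"
  shows "- z \<in> op_spectrum A"
proof (rule ccontr)
  assume "- z \<notin> op_spectrum A"
  then obtain R where R: "bounded_clinear R" "\<And>x. R (A x + z *\<^sub>C x) = x" "\<And>x. A (R x) + z *\<^sub>C R x = x"
    by (auto simp: op_spectrum_def complex_vector.scale_minus_left)
  have neg: "T (- x) = - T x" if "bounded_clinear T" for T :: "'a \<Rightarrow> 'a" and x
    using bounded_clinear_simps(2)[OF that, of 0 x] bounded_clinear_simps(5)[OF that] by simp
  have "- R (- A x - z *\<^sub>C x) = x" for x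
    using neg[OF R(1), of "A x + z *\<^sub>C x"] R(2)[of x] by simp
  moreover have "- A (- R x) - z *\<^sub>C (- R x) = x" for x
    using R(3)[of x] by (simp add: neg[OF A] complex_vector.scale_minus_right)
  ultimately have "z \<notin> op_spectrum (\<lambda>x. - A x)"
    unfolding op_spectrum_def using bounded_clinear_uminus[OF R(1)] by blast
  with z show False
    by blast
qed

lemma real_points_op_spectrum_uminus:
  assumes A: "bounded_clinear A"
  shows "t \<in> real_points (op_spectrum (\<lambda>x. - A x)) \<longleftrightarrow> - t \<in> real_points (op_spectrum A)"
  using op_spectrum_uminus_subset[OF A, of "of_real t"]
    op_spectrum_uminus_subset[OF bounded_clinear_uminus[OF A], of "of_real (- t)"]
  by (auto simp: real_points_def)

text \<open>The upper bound is the lower bound for \<open>- A\<close>.\<close>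
theorem quadratic_form_spectrum_bounds:
  fixes A :: "'a::complex_hilbert_space \<Rightarrow> 'a"
  assumes A: "bounded_clinear A" and sa: "self_adjoint A" and nontrivial: "\<exists>x::'a. x \<noteq> 0"
  defines "S \<equiv> real_points (op_spectrum A)"
  shows "bdd_below S" "bdd_above S"
    and "Inf S * (norm x)\<^sup>2 \<le> Re (cinner (A x) x)" "Re (cinner (A x) x) \<le> Sup S * (norm x)\<^sup>2"
proof -
  obtain \<mu> where \<mu>: "\<mu> \<in> S" "\<And>x. \<mu> * (norm x)\<^sup>2 \<le> Re (cinner (A x) x)"
    using form_minimum_in_spectrum[OF A sa nontrivial] by (auto simp: S_def)
  have ge: "\<mu> \<le> t" if "t \<in> S" for t
    using spectrum_ge_form_bound[OF A \<mu>(2)] that by (simp add: S_def)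
  note A' = bounded_clinear_uminus[OF A] and sa' = self_adjoint_uminus[OF sa]
  obtain \<nu> where \<nu>: "- \<nu> \<in> S" "\<And>x. \<nu> * (norm x)\<^sup>2 \<le> - Re (cinner (A x) x)"
    using form_minimum_in_spectrum[OF A' sa' nontrivial]
    by (auto simp: S_def real_points_op_spectrum_uminus[OF A])
  have le: "t \<le> - \<nu>" if "t \<in> S" for t
    using spectrum_ge_form_bound[OF A', of \<nu> "- t"] \<nu>(2) that
    by (simp add: S_def real_points_op_spectrum_uminus[OF A])
  show "bdd_below S"
    using ge by (rule bdd_belowI)
  show "bdd_above S"
    using le by (rule bdd_aboveI)
  have "Inf S = \<mu>" "Sup S = - \<nu>"
    using \<mu>(1) \<nu>(1) ge le by (auto intro: cInf_eq_minimum cSup_eq_maximum)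
  then show "Inf S * (norm x)\<^sup>2 \<le> Re (cinner (A x) x)" "Re (cinner (A x) x) \<le> Sup S * (norm x)\<^sup>2"
    using \<mu>(2)[of x] \<nu>(2)[of x] by simp_all
qed

section \<open>The essential spectrum is nonempty\<close>

lemma infinite_orthonormal_avoids_finite:
  assumes e: "orthonormal_on UNIV (e :: nat \<Rightarrow> 'a)" and "finite (F :: 'a::complex_hilbert_space set)"
  shows "\<exists>x. x \<noteq> 0 \<and> (\<forall>f\<in>F. cinner x f = 0)"
proof -
  let ?I = "{..<Suc (card F)}"
  have I: "orthonormal_on ?I e"
    using e by (rule orthonormal_on_subset) simp
  obtain \<alpha> where \<alpha>: "\<exists>i\<in>?I. \<alpha> i \<noteq> 0" "\<And>f. f \<in> F \<Longrightarrow> (\<Sum>i\<in>?I. \<alpha> i * cinner (e i) f) = 0"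
    using homogeneous_system_nontrivial[OF \<open>finite F\<close>, of ?I "\<lambda>i. cinner (e i)"] by auto
  define x where "x = (\<Sum>i\<in>?I. \<alpha> i *\<^sub>C e i)"
  have "x \<noteq> 0"
    using \<alpha>(1) coefficient_le_norm[OF I, of _ \<alpha>] unfolding x_def by force
  moreover have "cinner x f = 0" if "f \<in> F" for f
    using \<alpha>(2)[OF that] by (simp add: x_def cinner_sum_left cinner_scaleC_left del: sum.lessThan_Suc)
  ultimately show ?thesis
    by blast
qed

text \<open>The witness is the bottom \<open>t0\<close> of the essential spectrum: the supremum of all \<open>t\<close> for which
  \<open>A - t\<close> has a nonnegative form on the orthogonal complement of some finite set. If \<open>A - t0\<close> were
  Fredholm, it would be bounded below in norm on such a complement by Weyl's criterion, its form is
  almost nonnegative on another one, and orthogonally to the two finite sets and their images the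
  form of \<open>A - t0\<close> would be at least a positive multiple of \<open>\<parallel>x\<parallel>\<^sup>2\<close>. So \<open>t0\<close> could be increased.\<close>
theorem essential_spectrum_nonempty:
  fixes A :: "'a::complex_hilbert_space \<Rightarrow> 'a"
  assumes A: "bounded_clinear A" and sa: "self_adjoint A" and e: "orthonormal_on UNIV (e :: nat \<Rightarrow> 'a)"
  shows "real_points (essential_spectrum A) \<noteq> {}"
proof -
  obtain L where L: "L > 0" "\<And>x. norm (A x) \<le> L * norm x"
    using bounded_clinear_bound[OF A] by blast
  have form_le: "\<bar>Re (cinner (A x) x)\<bar> \<le> L * (norm x)\<^sup>2" for x
    using Re_cinner_le[of "A x" x] mult_right_mono[OF L(2)[of x], of "norm x"]
    by (simp add: power2_eq_square)
  define E where "E = {t. \<exists>F. finite F \<and>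
    (\<forall>x. (\<forall>f\<in>F. cinner x f = 0) \<longrightarrow> t * (norm x)\<^sup>2 \<le> Re (cinner (A x) x))}"
  have "- L \<in> E"
    unfolding E_def using form_le by (auto intro!: exI[of _ "{}"] simp: abs_le_iff minus_le_iff)
  have E_le: "t \<le> L" if t: "t \<in> E" for t
  proof -
    obtain F where F: "finite F"
      "\<And>x. \<forall>f\<in>F. cinner x f = 0 \<Longrightarrow> t * (norm x)\<^sup>2 \<le> Re (cinner (A x) x)"
      using t by (auto simp: E_def)
    obtain x where x: "x \<noteq> 0" "\<forall>f\<in>F. cinner x f = 0"
      using infinite_orthonormal_avoids_finite[OF e F(1)] by blast
    have "t * (norm x)\<^sup>2 \<le> L * (norm x)\<^sup>2"
      using F(2)[OF x(2)] form_le[of x] by linarith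
    then show ?thesis
      using x(1) by simp
  qed
  then have bdd: "bdd_above E"
    by (rule bdd_aboveI)
  define t0 where "t0 = Sup E"
  have "of_real t0 \<in> essential_spectrum A"
  proof (rule ccontr)
    let ?B = "\<lambda>x. A x - of_real t0 *\<^sub>C x"
    have B: "bounded_clinear ?B" "self_adjoint ?B"
      by (intro bounded_clinear_shift A self_adjoint_shift sa)+
    assume "of_real t0 \<notin> essential_spectrum A"
    then have "\<not> weyl_singular ?B"
      using fredholm_iff_not_weyl_singular[OF B] by (simp add: essential_spectrum_def)
    then obtain F0 \<eta> where F0: "finite F0" "\<eta> > 0"
      "\<nexists>x. (\<forall>f\<in>F0. cinner x f = 0) \<and> norm (?B x) < \<eta> * norm x"
      unfolding weyl_singular_def by blast
    have below: "\<eta> * norm x \<le> norm (?B x)" if "\<forall>f\<in>F0. cinner x f = 0" for x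
      using F0(3) that by (meson not_le)
    obtain M where M: "M > 0" "\<And>x. norm (?B x) \<le> M * norm x"
      using bounded_clinear_bound[OF B(1)] by blast
    define L' where "L' = M + \<eta>"
    define \<gamma> where "\<gamma> = \<eta>\<^sup>2 / (8 * L')"
    define \<epsilon> where "\<epsilon> = min (\<eta> / 2) \<gamma>"
    have "L' > 0"
      using M(1) F0(2) by (simp add: L'_def)
    moreover from this have "\<gamma> > 0"
      using F0(2) by (simp add: \<gamma>_def)
    moreover from this have "\<epsilon> > 0"
      using F0(2) by (simp add: \<epsilon>_def)
    moreover have "\<epsilon> \<le> \<eta> / 2" "\<epsilon> \<le> \<gamma>"
      unfolding \<epsilon>_def by (rule min.cobounded1 min.cobounded2)+
    ultimately have pos: "L' > 0" "\<gamma> > 0" "\<epsilon> > 0" "\<epsilon> \<le> \<eta> / 2" "\<epsilon> \<le> \<gamma>"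
      by blast+
    \<comment> \<open>orthogonally to a finite set, \<open>D\<close> is nonnegative and bounded below in norm by \<open>\<eta> / 2\<close>, so
      that its form is at least \<open>2 \<gamma>\<close>; undoing the shift by \<open>\<epsilon> \<le> \<gamma>\<close> leaves \<open>\<gamma>\<close>\<close>
    define D where "D = (\<lambda>x. A x - of_real (t0 - \<epsilon>) *\<^sub>C x)"
    have D: "bounded_clinear D" "self_adjoint D"
      unfolding D_def by (intro bounded_clinear_shift A self_adjoint_shift sa)+
    have D_B: "D x = ?B x + of_real \<epsilon> *\<^sub>C x" for x
      by (simp add: D_def complex_vector.scale_left_diff_distrib)
    have D_form: "Re (cinner (D x) x) = Re (cinner (A x) x) - (t0 - \<epsilon>) * (norm x)\<^sup>2" for x
      unfolding D_def by (simp only: cinner_diff_left cinner_scaleC_left cinner_self) simp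
    have \<epsilon>_x: "norm (of_real \<epsilon> *\<^sub>C x) = \<epsilon> * norm x" for x :: 'a
      using pos by (simp add: norm_scaleC)
    have D_le: "norm (D x) \<le> L' * norm x" for x
    proof -
      have "norm (D x) \<le> norm (?B x) + \<epsilon> * norm x"
        unfolding D_B using norm_triangle_ineq[of "?B x" "of_real \<epsilon> *\<^sub>C x"] by (simp only: \<epsilon>_x)
      also have "\<dots> \<le> M * norm x + \<eta> * norm x"
        using M(2)[of x] pos F0(2) by (intro add_mono mult_right_mono) auto
      finally show ?thesis
        by (simp add: L'_def algebra_simps)
    qed
    obtain t F1 where F1: "t0 - \<epsilon> < t" "finite F1"
      "\<And>x. \<forall>f\<in>F1. cinner x f = 0 \<Longrightarrow> t * (norm x)\<^sup>2 \<le> Re (cinner (A x) x)"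
    proof -
      have "t0 - \<epsilon> < Sup E"
        using pos by (simp add: t0_def)
      then obtain t where "t \<in> E" "t0 - \<epsilon> < t"
        using less_cSupD[of E] \<open>- L \<in> E\<close> by blast
      then show ?thesis
        using that by (auto simp: E_def)
    qed
    define F where "F = F0 \<union> F1"
    have D_pos: "0 \<le> Re (cinner (D x) x)" if "\<forall>f\<in>F. cinner x f = 0" for x
    proof -
      have "(t0 - \<epsilon>) * (norm x)\<^sup>2 \<le> t * (norm x)\<^sup>2"
        using F1(1) by (intro mult_right_mono) auto
      then show ?thesis
        using F1(3)[of x] that by (simp add: D_form F_def)
    qed
    have "(t0 + \<gamma>) * (norm x)\<^sup>2 \<le> Re (cinner (A x) x)"
      if x: "\<forall>f\<in>F \<union> D ` F. cinner x f = 0" for x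
    proof -
      have "\<forall>f\<in>F. cinner (D x) f = 0"
        using x D(2) by (auto simp: self_adjoint_def)
      then have "(norm (D x))\<^sup>2 \<le> L' * Re (cinner (D x) x)"
        using x by (intro norm_square_le_form[OF D pos(1) D_le D_pos, of F]) auto
      moreover have "\<eta> / 2 * norm x \<le> norm (D x)"
      proof -
        have "\<eta> * norm x \<le> norm (?B x)"
          using x by (intro below) (auto simp: F_def)
        also have "\<dots> \<le> norm (D x) + \<epsilon> * norm x"
          using norm_triangle_ineq4[of "D x" "of_real \<epsilon> *\<^sub>C x"] by (simp only: \<epsilon>_x) (simp add: D_B)
        also have "\<dots> \<le> norm (D x) + \<eta> / 2 * norm x"
          using pos by (intro add_left_mono mult_right_mono) auto
        finally show ?thesis
          by simp
      qed
      then have "(\<eta> / 2)\<^sup>2 * (norm x)\<^sup>2 \<le> (norm (D x))\<^sup>2"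
        using F0(2) power_mono[of "\<eta> / 2 * norm x" "norm (D x)" 2]
        unfolding power_mult_distrib by simp
      ultimately have "(\<eta> / 2)\<^sup>2 * (norm x)\<^sup>2 \<le> L' * Re (cinner (D x) x)"
        by linarith
      then have "2 * \<gamma> * (norm x)\<^sup>2 \<le> Re (cinner (D x) x)"
        using pos(1) by (simp add: \<gamma>_def field_simps power2_eq_square)
      moreover have "\<epsilon> * (norm x)\<^sup>2 \<le> \<gamma> * (norm x)\<^sup>2"
        using pos(5) by (intro mult_right_mono) auto
      ultimately show ?thesis
        unfolding D_form by (simp add: algebra_simps)
    qed
    moreover have "finite (F \<union> D ` F)"
      using F0(1) F1(2) by (simp add: F_def)
    ultimately have "t0 + \<gamma> \<in> E"
      unfolding E_def by blast
    then have "t0 + \<gamma> \<le> t0"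
      unfolding t0_def using bdd by (rule cSup_upper)
    then show False
      using pos by simp
  qed
  then show ?thesis
    by (auto simp: real_points_def)
qed

section \<open>Orthonormal eigenvectors of the truncations\<close>

lemma orthogonal_projection_eqI:
  assumes M: "complex_vector.subspace M" and y: "y \<in> M" "\<And>z. z \<in> M \<Longrightarrow> cinner (x - y) z = 0"
  shows "orthogonal_projection M x = y"
  unfolding orthogonal_projection_def
proof (rule the_equality)
  fix y'
  assume y': "y' \<in> M \<and> (\<forall>z\<in>M. cinner (x - y') z = 0)"
  have "y' - y \<in> M"
    using M y y' by (intro complex_vector.subspace_diff) auto
  then have "cinner ((x - y) - (x - y')) (y' - y) = 0"
    using y y' unfolding cinner_diff_left[of "x - y"] by simp
  then have "cinner (y' - y) (y' - y) = 0"
    by simp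
  then show "y' = y"
    by (simp add: cinner_self)
qed (use y in blast)

lemma truncation_matrix_entry:
  assumes e: "orthonormal_on UNIV e" and ij: "i < n" "j < n"
  shows "truncation_matrix A e n $$ (i, j) = cinner (A (e j)) (e i)"
proof -
  define V where "V = cspan (e ` {..<n})"
  have V: "complex_vector.subspace V" and e_V: "\<And>k. k < n \<Longrightarrow> e k \<in> V"
    by (auto simp: V_def intro: complex_vector.span_base)
  have "orthogonal_projection V (e j) = e j"
    using V e_V ij by (intro orthogonal_projection_eqI) auto
  moreover have "cinner (orthogonal_projection V x) (e i) = cinner x (e i)" for x
  proof -
    define y where "y = (\<Sum>k<n. cinner x (e k) *\<^sub>C e k)"
    have y: "cinner y (e k) = cinner x (e k)" if "k < n" for k
      using that cinner_orthonormal_combination[OF orthonormal_on_subset[OF e]]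
      by (simp add: y_def)
    have "orthogonal_projection V x = y"
    proof (rule orthogonal_projection_eqI[OF V])
      show "y \<in> V"
        using e_V V unfolding y_def
        by (intro complex_vector.subspace_sum complex_vector.subspace_scale) auto
      show "cinner (x - y) z = 0" if "z \<in> V" for z
        using that unfolding V_def
        by (rule cinner_cspan_zero') (auto simp: cinner_diff_left y)
    qed
    then show ?thesis
      using y ij by simp
  qed
  ultimately show ?thesis
    using ij by (simp add: truncation_matrix_def truncation_def flip: V_def)
qed

lemma mat_mult_entry:
  assumes "X \<in> carrier_mat n n" "Y \<in> carrier_mat n n" "i < n" "j < n"
  shows "(X * Y) $$ (i, j) = (\<Sum>k<n. X $$ (i, k) * Y $$ (k, j))"
  using assms by (simp add: scalar_prod_def lessThan_atLeast0)

lemma orthonormalization_step: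
  "\<exists>r. \<exists>s\<in>cspan (p ` {..<k}). orthonormalization p k = r *\<^sub>C (p k - s)"
proof -
  let ?u = "orthonormalization p"
  define s where "s = (\<Sum>j<k. cinner (p k) (?u j) *\<^sub>C ?u j)"
  have "s \<in> cspan (?u ` {..<k})"
    unfolding s_def
    by (intro complex_vector.span_sum complex_vector.span_scale complex_vector.span_base) auto
  moreover have "?u k = of_real (1 / norm (p k - s)) *\<^sub>C (p k - s)"
    by (subst orthonormalization.simps) (simp add: s_def sgn_div_norm divide_inverse scaleR_scaleC)
  ultimately show ?thesis
    unfolding cspan_orthonormalization by blast
qed

text \<open>Schur triangularization puts the eigenvalues on the diagonal in any prescribed order, with their
  algebraic multiplicities. Its basis vectors span a flag of invariant subspaces; orthonormalizing
  along the flag keeps the matrix triangular with the same diagonal, and self-adjointness makes a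
  triangular matrix in an orthonormal basis diagonal.\<close>
lemma truncation_orthonormal_eigenbasis:
  fixes A :: "'a::complex_hilbert_space \<Rightarrow> 'a"
  assumes A: "bounded_clinear A" and sa: "self_adjoint A" and e: "orthonormal_on UNIV e"
    and ev: "decreasing_eigenvalues n (truncation_matrix A e n) l"
  shows "\<exists>u. orthonormal_on {..<n} u \<and> cspan (u ` {..<n}) = cspan (e ` {..<n}) \<and>
    (\<forall>j<n. \<forall>k<n. cinner (A (u j)) (u k) = (if j = k then of_real (l j) else 0))"
proof -
  define M where "M = truncation_matrix A e n"
  have M: "M \<in> carrier_mat n n"
    by (simp add: M_def truncation_matrix_def)
  define es where "es = map (\<lambda>k. complex_of_real (l k)) [0..<n]"
  have "char_poly M = (\<Prod>x\<leftarrow>es. [:- x, 1:])"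
    using ev prod.distinct_set_conv_list[of "[0..<n]" "\<lambda>k. [:- complex_of_real (l k), 1:]"]
    by (simp add: decreasing_eigenvalues_def es_def M_def lessThan_atLeast0 o_def)
  moreover obtain B P Q where schur: "schur_decomposition M es = (B, P, Q)"
    by (metis prod_cases3)
  ultimately have BPQ: "similar_mat_wit M B P Q" "upper_triangular B" "diag_mat B = es"
    using schur_decomposition[OF M] by blast+
  note D = similar_mat_witD2[OF M BPQ(1)]
  have carrier: "B \<in> carrier_mat n n" "P \<in> carrier_mat n n" "Q \<in> carrier_mat n n"
    and PQ: "P * Q = 1\<^sub>m n" "Q * P = 1\<^sub>m n" and MB: "M = P * B * Q"
    using D by auto
  have MP: "M * P = P * B"
    unfolding MB using carrier PQ by (simp add: assoc_mult_mat[of _ n n _ n _ n])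
  have B_low: "B $$ (i, k) = 0" if "k < i" "i < n" for i k
    using BPQ(2) carrier that by (auto simp: upper_triangular_def)
  have B_diag: "B $$ (k, k) = of_real (l k)" if "k < n" for k
  proof -
    have "diag_mat B ! k = es ! k"
      by (simp add: BPQ(3))
    then show ?thesis
      using that carrier by (simp add: diag_mat_def es_def)
  qed

  \<comment> \<open>the columns of \<open>P\<close> span a flag of invariant subspaces of the truncation\<close>
  define p where "p = (\<lambda>k. \<Sum>i<n. P $$ (i, k) *\<^sub>C e i)"
  define V where "V = cspan (e ` {..<n})"
  have e_n: "orthonormal_on {..<n} e"
    using e by (rule orthonormal_on_subset) simp
  have p_e: "cinner (p k) (e i) = P $$ (i, k)" if "i < n" for i k
    using cinner_orthonormal_combination[OF e_n] that by (simp add: p_def)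
  have p_V: "p k \<in> V" for k
    unfolding p_def V_def
    by (intro complex_vector.span_sum complex_vector.span_scale complex_vector.span_base) auto
  have "e i \<in> cspan (p ` {..<n})" if "i < n" for i
  proof -
    have "(\<Sum>k<n. Q $$ (k, i) *\<^sub>C p k) = (\<Sum>j<n. (\<Sum>k<n. P $$ (j, k) * Q $$ (k, i)) *\<^sub>C e j)"
      unfolding p_def complex_vector.scale_sum_right complex_vector.scale_sum_left scaleC_scaleC
      by (subst sum.swap) (simp add: mult.commute)
    also have "\<dots> = (\<Sum>j<n. (1\<^sub>m n $$ (j, i)) *\<^sub>C e j)"
      using mat_mult_entry[OF carrier(2,3)] that by (intro sum.cong) (auto simp flip: PQ(1))
    also have "\<dots> = (\<Sum>j<n. if j = i then e j else 0)"
      using that by (intro sum.cong) auto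
    also have "\<dots> = e i"
      using that by simp
    finally have "e i = (\<Sum>k<n. Q $$ (k, i) *\<^sub>C p k)"
      by simp
    also have "\<dots> \<in> cspan (p ` {..<n})"
      by (intro complex_vector.span_sum complex_vector.span_scale complex_vector.span_base) auto
    finally show ?thesis .
  qed
  then have span_p: "cspan (p ` {..<n}) = V"
    using p_V unfolding V_def by (intro complex_vector.span_eq[THEN iffD2]) auto
  have indep: "p k \<notin> cspan (p ` {..<k})" if "k < n" for k
  proof
    \<comment> \<open>the rows of \<open>Q = P\<^sup>-\<^sup>1\<close> give the dual basis of the \<open>p k\<close>\<close>
    define g where "g = (\<Sum>i<n. cnj (Q $$ (k, i)) *\<^sub>C e i)"
    have g: "cinner (p j) g = (if j = k then 1 else 0)" if "j < n" for j
    proof -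
      have "cinner (p j) g = (Q * P) $$ (k, j)"
        using mat_mult_entry[OF carrier(3,2)] that \<open>k < n\<close>
        by (simp add: g_def cinner_sum_right cinner_scaleC_right p_e)
      then show ?thesis
        using that \<open>k < n\<close> by (auto simp: PQ)
    qed
    assume "p k \<in> cspan (p ` {..<k})"
    then have "cinner (p k) g = 0"
      by (rule cinner_cspan_zero) (use g \<open>k < n\<close> in auto)
    with g[OF \<open>k < n\<close>] show False
      by simp
  qed

  \<comment> \<open>\<open>A\<close> need not map the flag into the span \<open>V\<close>, so the action of the truncation is expressed by
    inner products with the vectors of \<open>V\<close>\<close>
  have A_p: "\<exists>s\<in>cspan (p ` {..<k}). \<forall>v\<in>V. cinner (A (p k)) v = cinner (of_real (l k) *\<^sub>C p k + s) v"
    if "k < n" for k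
  proof (intro bexI ballI)
    let ?s = "\<Sum>i<k. B $$ (i, k) *\<^sub>C p i"
    show "?s \<in> cspan (p ` {..<k})"
      by (intro complex_vector.span_sum complex_vector.span_scale complex_vector.span_base) auto
    fix v
    assume v: "v \<in> V"
    have entry: "cinner (A (p k)) (e j) = cinner (of_real (l k) *\<^sub>C p k + ?s) (e j)" if "j < n" for j
    proof -
      have "cinner (A (p k)) (e j) = (\<Sum>i<n. M $$ (j, i) * P $$ (i, k))"
        unfolding p_def using that
        by (simp add: bounded_clinear_simps[OF A] cinner_sum_left cinner_scaleC_left M_def
            truncation_matrix_entry[OF e] mult.commute)
      also have "\<dots> = (\<Sum>i<n. P $$ (j, i) * B $$ (i, k))"
        using mat_mult_entry[OF M carrier(2)] mat_mult_entry[OF carrier(2,1)] that \<open>k < n\<close>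
        by (simp add: MP)
      also have "\<dots> = (\<Sum>i<Suc k. P $$ (j, i) * B $$ (i, k))"
        using \<open>k < n\<close> B_low by (intro sum.mono_neutral_right) auto
      finally show ?thesis
        using \<open>k < n\<close> that
        by (simp add: cinner_algebra p_e B_diag mult.commute)
    qed
    have "cinner (A (p k) - (of_real (l k) *\<^sub>C p k + ?s)) v = 0"
      using v unfolding V_def
      by (rule cinner_cspan_zero') (auto simp: cinner_diff_left[of "A (p k)"] entry)
    then show "cinner (A (p k)) v = cinner (of_real (l k) *\<^sub>C p k + ?s) v"
      by (simp add: cinner_diff_left[of "A (p k)"])
  qed
  have A_flag: "\<exists>s\<in>cspan (p ` {..<k}). \<forall>v\<in>V. cinner (A x) v = cinner s v"
    if x: "x \<in> cspan (p ` {..<k})" and "k \<le> n" for x k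
    using x
  proof (induction rule: complex_vector.span_induct_alt)
    case base
    then show ?case
      by (intro bexI[of _ 0]) (auto simp: bounded_clinear_simps[OF A] complex_vector.span_zero)
  next
    case (step c y z)
    then obtain i where i: "i < k" "y = p i"
      by auto
    with A_p[of i] \<open>k \<le> n\<close> obtain s where s: "s \<in> cspan (p ` {..<i})"
      "\<And>v. v \<in> V \<Longrightarrow> cinner (A (p i)) v = cinner (of_real (l i) *\<^sub>C p i + s) v"
      by auto
    obtain s' where s': "s' \<in> cspan (p ` {..<k})" "\<And>v. v \<in> V \<Longrightarrow> cinner (A z) v = cinner s' v"
      using step by blast
    have "s \<in> cspan (p ` {..<k})"
      using s(1) complex_vector.span_mono[OF image_mono[of "{..<i}" "{..<k}"]] i(1) by auto
    then have "c *\<^sub>C (of_real (l i) *\<^sub>C p i + s) + s' \<in> cspan (p ` {..<k})"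
      using i(1) s'(1)
      by (intro complex_vector.span_add complex_vector.span_scale) (auto intro: complex_vector.span_base)
    then show ?case
      using s(2) s'(2) i(2)
      by (intro bexI[of _ "c *\<^sub>C (of_real (l i) *\<^sub>C p i + s) + s'"])
        (simp_all add: bounded_clinear_simps[OF A] cinner_add_left[of "c *\<^sub>C _"] cinner_scaleC_left[of c])
  qed

  define u where "u = orthonormalization p"
  have span_u: "cspan (u ` {..<k}) = cspan (p ` {..<k})" for k
    by (simp add: u_def cspan_orthonormalization)
  have "u k \<noteq> 0" if "k < n" for k
  proof
    assume "u k = 0"
    then have "cspan (u ` {..<Suc k}) = cspan (u ` {..<k})"
      by (simp add: lessThan_Suc complex_vector.span_insert_0)
    then have "p k \<in> cspan (p ` {..<k})"
      unfolding span_u by (auto intro: complex_vector.span_base)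
    with indep[OF that] show False
      by blast
  qed
  then have u: "orthonormal_on {..<n} u"
    using orthonormalization_self[of p] orthonormalization_orthogonal[of _ _ p]
    by (auto simp: orthonormal_on_def u_def)
  have u_V: "u k \<in> V" if "k < n" for k
    using that span_u[of n] span_p by (auto intro: complex_vector.span_base)
  have A_u: "\<exists>s\<in>cspan (u ` {..<k}). \<forall>v\<in>V. cinner (A (u k)) v = cinner (of_real (l k) *\<^sub>C u k + s) v"
    if k: "k < n" for k
  proof -
    obtain r s0 where r: "s0 \<in> cspan (p ` {..<k})" "u k = r *\<^sub>C (p k - s0)"
      using orthonormalization_step[of p k] by (auto simp: u_def)
    obtain s1 where s1: "s1 \<in> cspan (p ` {..<k})"
      "\<And>v. v \<in> V \<Longrightarrow> cinner (A (p k)) v = cinner (of_real (l k) *\<^sub>C p k + s1) v"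
      using A_p[OF k] by blast
    obtain s2 where s2: "s2 \<in> cspan (p ` {..<k})" "\<And>v. v \<in> V \<Longrightarrow> cinner (A s0) v = cinner s2 v"
      using A_flag[OF r(1)] k by auto
    define s where "s = r *\<^sub>C (of_real (l k) *\<^sub>C s0 + s1 - s2)"
    have "s \<in> cspan (u ` {..<k})"
      unfolding s_def span_u using r s1 s2
      by (intro complex_vector.span_add complex_vector.span_diff complex_vector.span_scale)
    moreover have "cinner (A (u k)) v = cinner (of_real (l k) *\<^sub>C u k + s) v" if "v \<in> V" for v
      using s1(2)[OF that] s2(2)[OF that]
      by (simp add: r(2) s_def bounded_clinear_simps[OF A] cinner_algebra algebra_simps)
    ultimately show ?thesis
      by blast
  qed
  have upper: "cinner (A (u j)) (u k) = (if j = k then of_real (l j) else 0)"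
    if jk: "j \<le> k" "k < n" for j k
  proof -
    obtain s where s: "s \<in> cspan (u ` {..<j})"
      "cinner (A (u j)) (u k) = cinner (of_real (l j) *\<^sub>C u j + s) (u k)"
      using A_u[of j] u_V[of k] jk by auto
    have "cinner s (u k) = 0"
      using s(1) by (rule cinner_cspan_zero) (use u that in \<open>auto simp: orthonormal_on_def\<close>)
    then show ?thesis
      using s(2) u that by (auto simp: cinner_add_left cinner_scaleC_left orthonormal_on_def)
  qed
  have "cinner (A (u j)) (u k) = (if j = k then of_real (l j) else 0)" if "j < n" "k < n" for j k
  proof (cases "j \<le> k")
    case False
    then have "cinner (A (u k)) (u j) = 0"
      using upper[of k j] that by simp
    then have "cinner (u j) (A (u k)) = 0"
      by (simp add: cinner_eq_0_commute[of "u j"])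
    then show ?thesis
      using False sa by (simp add: self_adjoint_def)
  qed (use upper that in simp)
  moreover have "cspan (u ` {..<n}) = cspan (e ` {..<n})"
    by (simp add: span_u span_p V_def)
  ultimately show ?thesis
    using u by blast
qed

section \<open>Counting eigenvalues near the essential spectrum\<close>

lemma orthonormal_expansion:
  assumes u: "orthonormal_on {..<n} u" and v: "v \<in> cspan (u ` {..<n})"
  shows "v = (\<Sum>j<n. cinner v (u j) *\<^sub>C u j)"
proof -
  let ?s = "\<Sum>j<n. cinner v (u j) *\<^sub>C u j"
  have "v - ?s \<in> cspan (u ` {..<n})"
    using v by (intro complex_vector.span_diff complex_vector.span_sum complex_vector.span_scale)
      (auto intro: complex_vector.span_base)
  then have "cinner (v - ?s) (v - ?s) = 0"
    by (rule cinner_cspan_zero')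
      (auto simp: cinner_diff_left cinner_orthonormal_combination[OF u])
  then show ?thesis
    by (simp add: cinner_self)
qed

lemma cspan_range_finite_stage:
  assumes "x \<in> cspan (range e)"
  shows "\<exists>m. x \<in> cspan (e ` {..<m::nat})"
  using assms
proof (induction rule: complex_vector.span_induct_alt)
  case base
  then show ?case
    by (auto simp: complex_vector.span_zero)
next
  case (step c x y)
  then obtain i m where i: "x = e i" and m: "y \<in> cspan (e ` {..<m})"
    by blast
  have "y \<in> cspan (e ` {..<max m (Suc i)})"
    using m complex_vector.span_mono[OF image_mono[of "{..<m}" "{..<max m (Suc i)}"]] by auto
  moreover have "x \<in> cspan (e ` {..<max m (Suc i)})"
    unfolding i by (intro complex_vector.span_base) auto
  ultimately show ?case
    by (intro exI[of _ "max m (Suc i)"] complex_vector.span_add complex_vector.span_scale)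
qed

text \<open>Testing \<open>A v - t v\<close> against the eigenvectors \<open>u j\<close> multiplies the coordinates of \<open>v\<close>
  by \<open>l j - t\<close>, and Bessel's inequality bounds the norm of \<open>A v - t v\<close> from below.\<close>
lemma norm_shift_ge_off_eigenvalues:
  fixes A :: "'a::complex_hilbert_space \<Rightarrow> 'a"
  assumes A: "bounded_clinear A" and u: "orthonormal_on {..<n} u"
    and Au: "\<And>j k. j < n \<Longrightarrow> k < n \<Longrightarrow> cinner (A (u j)) (u k) = (if j = k then of_real (l j) else 0)"
    and v: "v \<in> cspan (u ` {..<n})" and "\<epsilon> > 0"
    and orth: "\<And>j. j < n \<Longrightarrow> \<bar>l j - t\<bar> < \<epsilon> \<Longrightarrow> cinner v (u j) = 0"
  shows "\<epsilon> * norm v \<le> norm (A v - of_real t *\<^sub>C v)"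
proof -
  let ?c = "\<lambda>j. cinner v (u j)"
  note v_eq = orthonormal_expansion[OF u v]
  have coord: "cinner (A v - of_real t *\<^sub>C v) (u k) = of_real (l k - t) * ?c k" if "k < n" for k
  proof -
    have "cinner (A v) (u k) = (\<Sum>j<n. ?c j * cinner (A (u j)) (u k))"
      by (subst v_eq) (simp add: bounded_clinear_simps[OF A] cinner_sum_left cinner_scaleC_left)
    also have "\<dots> = (\<Sum>j<n. if j = k then ?c k * of_real (l k) else 0)"
      using that by (intro sum.cong) (auto simp: Au)
    finally show ?thesis
      using that by (simp add: cinner_diff_left cinner_scaleC_left algebra_simps)
  qed
  have "(\<epsilon> * norm v)\<^sup>2 = (\<Sum>k<n. (\<epsilon> * cmod (?c k))\<^sup>2)"
  proof -
    have "(norm v)\<^sup>2 = (\<Sum>k<n. (cmod (?c k))\<^sup>2)"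
      by (subst v_eq) (rule norm_orthonormal_combination[OF u], simp)
    then show ?thesis
      by (simp add: power_mult_distrib sum_distrib_left)
  qed
  also have "\<dots> \<le> (\<Sum>k<n. (cmod (cinner (A v - of_real t *\<^sub>C v) (u k)))\<^sup>2)"
  proof (intro sum_mono power_mono)
    fix k
    assume "k \<in> {..<n}"
    then show "\<epsilon> * cmod (?c k) \<le> cmod (cinner (A v - of_real t *\<^sub>C v) (u k))"
      using orth[of k] \<open>\<epsilon> > 0\<close>
      by (cases "\<bar>l k - t\<bar> < \<epsilon>") (auto simp: coord norm_mult simp del: of_real_diff intro: mult_right_mono)
  qed (use \<open>\<epsilon> > 0\<close> in auto)
  also have "\<dots> \<le> (norm (A v - of_real t *\<^sub>C v))\<^sup>2"
    by (rule bessel_inequality[OF u]) simp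
  finally show ?thesis
    by (rule power2_le_imp_le) simp
qed

text \<open>By Weyl's criterion there are \<open>N\<close> orthonormal vectors that \<open>A - t\<close> almost annihilates. Slightly
  perturbed, they lie in the span of the first \<open>n\<close> basis vectors for all large \<open>n\<close>. If fewer than
  \<open>N\<close> eigenvalues of the truncation were \<open>\<epsilon>\<close>-close to \<open>t\<close>, some nonzero combination of these
  vectors would be orthogonal to all the corresponding eigenvectors; then \<open>A - t\<close> could not shrink it
  by a factor below \<open>\<epsilon>\<close>.\<close>
theorem many_eigenvalues_near_essential_spectrum:
  fixes A :: "'a::complex_hilbert_space \<Rightarrow> 'a"
  assumes A: "bounded_clinear A" and sa: "self_adjoint A" and e: "orthonormal_basis e"
    and ev: "\<And>n. n \<ge> 1 \<Longrightarrow> decreasing_eigenvalues n (truncation_matrix A e n) (lam n)"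
    and t: "t \<in> real_points (essential_spectrum A)" and "\<epsilon> > 0"
  shows "\<exists>n0. \<forall>n\<ge>n0. N \<le> card {j. j < n \<and> \<bar>lam n j - t\<bar> < \<epsilon>}"
proof (cases "N = 0")
  case False
  then have N: "real N > 0"
    by simp
  define B where "B = (\<lambda>x. A x - of_real t *\<^sub>C x)"
  have B: "bounded_clinear B" "self_adjoint B"
    unfolding B_def by (intro bounded_clinear_shift A self_adjoint_shift sa)+
  have e': "orthonormal_on UNIV e" and dense: "closure (cspan (range e)) = UNIV"
    using e by (auto simp: orthonormal_basis_def orthonormal_on_def)
  have "weyl_singular B"
    using t fredholm_iff_not_weyl_singular[OF B]
    by (simp add: real_points_def essential_spectrum_def B_def)
  obtain M where M: "M > 0" "\<And>x. norm (B x) \<le> M * norm x"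
    using bounded_clinear_bound[OF B(1)] by blast
  \<comment> \<open>\<open>\<eta>\<close> is so small that the errors from all \<open>N\<close> vectors add up to at most \<open>\<epsilon> / 2\<close>\<close>
  define s where "s = 1 + M + \<epsilon>"
  define \<eta> where "\<eta> = \<epsilon> / (2 * real N * s)"
  have \<eta>: "\<eta> > 0" "real N * \<eta> * (1 + M + \<epsilon>) = \<epsilon> / 2"
  proof -
    have "s > 0"
      using \<open>\<epsilon> > 0\<close> M by (simp add: s_def)
    then have "\<eta> > 0" "real N * \<eta> * s = \<epsilon> / 2"
      using \<open>\<epsilon> > 0\<close> N by (simp_all add: \<eta>_def)
    then show "\<eta> > 0" "real N * \<eta> * (1 + M + \<epsilon>) = \<epsilon> / 2"
      unfolding s_def by simp_all
  qed
  obtain x where x: "orthonormal_on UNIV x" "\<And>i. norm (B (x i)) < \<eta>"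
    using weyl_singular_sequence[OF B(1) \<open>weyl_singular B\<close>, of "\<lambda>_. \<eta>"] \<eta>(1) by blast
  then have xN: "orthonormal_on {..<N} x"
    by (auto intro: orthonormal_on_subset)
  have "\<forall>i. \<exists>y. y \<in> cspan (range e) \<and> dist y (x i) < \<eta>"
    using dense \<eta>(1) closure_approachable[of "x _" "cspan (range e)"] by blast
  from choice[OF this] obtain y where y: "\<And>i. y i \<in> cspan (range e)" "\<And>i. dist (y i) (x i) < \<eta>"
    by blast
  have "\<forall>i. \<exists>m. y i \<in> cspan (e ` {..<m})"
    using cspan_range_finite_stage[OF y(1)] by blast
  from choice[OF this] obtain m where m: "\<And>i. y i \<in> cspan (e ` {..<m i})"
    by blast
  define n0 where "n0 = Suc (\<Sum>i<N. m i)"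
  have "N \<le> card {j. j < n \<and> \<bar>lam n j - t\<bar> < \<epsilon>}" if n: "n \<ge> n0" for n
  proof (rule ccontr)
    define J where "J = {j. j < n \<and> \<bar>lam n j - t\<bar> < \<epsilon>}"
    assume "\<not> N \<le> card {j. j < n \<and> \<bar>lam n j - t\<bar> < \<epsilon>}"
    then have J: "finite J" "card J < card {..<N}"
      by (simp_all add: J_def)
    have "n \<ge> 1"
      using n by (simp add: n0_def)
    obtain u where u: "orthonormal_on {..<n} u" "cspan (u ` {..<n}) = cspan (e ` {..<n})"
      "\<And>j k. j < n \<Longrightarrow> k < n \<Longrightarrow> cinner (A (u j)) (u k) = (if j = k then of_real (lam n j) else 0)"
      using truncation_orthonormal_eigenbasis[OF A sa e' ev[OF \<open>n \<ge> 1\<close>]] by blast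
    obtain \<alpha> where \<alpha>: "\<exists>i\<in>{..<N}. \<alpha> i \<noteq> 0"
      "\<And>j. j \<in> J \<Longrightarrow> (\<Sum>i<N. \<alpha> i * cinner (y i) (u j)) = 0"
      using homogeneous_system_nontrivial[OF J(1) finite_lessThan J(2), of "\<lambda>i j. cinner (y i) (u j)"]
      by blast
    define v where "v = (\<Sum>i<N. \<alpha> i *\<^sub>C y i)"
    define X where "X = (\<Sum>i<N. \<alpha> i *\<^sub>C x i)"
    obtain i where i: "i < N" "\<alpha> i \<noteq> 0"
      using \<alpha>(1) by auto
    then have "cmod (\<alpha> i) \<le> norm X"
      unfolding X_def by (intro coefficient_le_norm[OF xN]) auto
    then have X: "norm X > 0"
      using i(2) by (metis norm_le_zero_iff not_le order_trans zero_less_norm_iff)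
    have vX: "norm (v - X) \<le> real N * \<eta> * norm X"
    proof -
      have "v - X = (\<Sum>i<N. \<alpha> i *\<^sub>C (y i - x i))"
        by (simp add: v_def X_def complex_vector.scale_right_diff_distrib sum_subtractf)
      then show ?thesis
        using small_on_combination[OF xN, of "\<lambda>i. y i - x i" \<eta> \<alpha>] y(2)
        by (simp add: X_def dist_norm less_imp_le)
    qed
    have BX: "norm (B X) \<le> real N * \<eta> * norm X"
      unfolding X_def bounded_clinear_simps[OF B(1)]
      using small_on_combination[OF xN, of "\<lambda>i. B (x i)" \<eta> \<alpha>] x(2)
      by (simp add: less_imp_le)
    have "y i \<in> cspan (u ` {..<n})" if "i < N" for i
    proof -
      have "m i \<le> (\<Sum>i<N. m i)"
        using that by (intro member_le_sum) auto
      then have "{..<m i} \<subseteq> {..<n}"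
        using n by (auto simp: n0_def)
      then show ?thesis
        using m[of i] complex_vector.span_mono[OF image_mono] unfolding u(2) by blast
    qed
    then have "v \<in> cspan (u ` {..<n})"
      unfolding v_def by (intro complex_vector.span_sum complex_vector.span_scale) auto
    moreover have "cinner v (u j) = 0" if "j < n" "\<bar>lam n j - t\<bar> < \<epsilon>" for j
      using \<alpha>(2)[of j] that by (simp add: J_def v_def cinner_sum_left cinner_scaleC_left)
    ultimately have "\<epsilon> * norm v \<le> norm (B v)"
      unfolding B_def using norm_shift_ge_off_eigenvalues[OF A u(1,3) _ \<open>\<epsilon> > 0\<close>] by blast
    also have "\<dots> \<le> norm (B X) + norm (B (v - X))"
      using norm_triangle_ineq[of "B X" "B (v - X)"] by (simp add: bounded_clinear_simps[OF B(1)])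
    also have "\<dots> \<le> real N * \<eta> * norm X + M * (real N * \<eta> * norm X)"
      using BX M(2)[of "v - X"] mult_left_mono[OF vX, of M] M(1) by linarith
    finally have upper: "\<epsilon> * norm v \<le> real N * \<eta> * norm X + M * (real N * \<eta> * norm X)" .
    have "norm X - real N * \<eta> * norm X \<le> norm v"
      using vX norm_triangle_ineq2[of X v] by (simp add: norm_minus_commute)
    then have "\<epsilon> * (norm X - real N * \<eta> * norm X) \<le> \<epsilon> * norm v"
      using \<open>\<epsilon> > 0\<close> by (intro mult_left_mono) auto
    with upper have "\<epsilon> * norm X \<le> (real N * \<eta> * (1 + M + \<epsilon>)) * norm X"
      by (simp add: algebra_simps)
    then show False
      unfolding \<eta>(2) using X \<open>\<epsilon> > 0\<close> by simp
  qed
  then show ?thesis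
    by blast
qed simp

section \<open>The gap\<close>

lemma eigenvalue_between_spectrum_bounds:
  fixes A :: "'a::complex_hilbert_space \<Rightarrow> 'a"
  assumes A: "bounded_clinear A" and sa: "self_adjoint A" and e: "orthonormal_on UNIV e"
    and ev: "decreasing_eigenvalues n (truncation_matrix A e n) l" and "j < n"
  shows "Inf (real_points (op_spectrum A)) \<le> l j \<and> l j \<le> Sup (real_points (op_spectrum A))"
proof -
  obtain u where u: "orthonormal_on {..<n} u"
    "\<forall>j<n. \<forall>k<n. cinner (A (u j)) (u k) = (if j = k then of_real (l j) else 0)"
    using truncation_orthonormal_eigenbasis[OF A sa e ev] by blast
  have "Re (cinner (A (u j)) (u j)) = l j" "(norm (u j))\<^sup>2 = 1"
    using u \<open>j < n\<close> by (auto simp: orthonormal_on_def norm_square_cinner)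
  moreover have nontrivial: "\<exists>x::'a. x \<noteq> 0"
    using \<open>(norm (u j))\<^sup>2 = 1\<close> by (intro exI[of _ "u j"]) auto
  ultimately show ?thesis
    using quadratic_form_spectrum_bounds(3,4)[OF A sa nontrivial, of "u j"] by simp
qed

theorem theorem3p1:
  fixes A :: "'a::complex_hilbert_space \<Rightarrow> 'a"
    and e :: "nat \<Rightarrow> 'a"
    and lam w :: "nat \<Rightarrow> nat \<Rightarrow> real"
  assumes "bounded_clinear A" and "self_adjoint A"
    and "orthonormal_basis e"
    and "\<And>n. n \<ge> 1 \<Longrightarrow> decreasing_eigenvalues n (truncation_matrix A e n) (lam n)"
    and "\<And>n k. n \<ge> 1 \<Longrightarrow> k < n \<Longrightarrow> 0 \<le> w n k \<and> w n k \<le> 1"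
    and "\<And>n. n \<ge> 1 \<Longrightarrow> (\<Sum>k<n. w n k) = 1"
    and "\<exists>\<delta>>0. \<exists>K>0. \<forall>n\<ge>1.
      real (card {j. j < n \<and> \<bar>(\<Sum>k<n. w n k * lam n k) - lam n j\<bar> < \<delta>}) < K"
    and "Inf (real_points (essential_spectrum A)) = Inf (real_points (op_spectrum A))"
    and "Sup (real_points (essential_spectrum A)) = Sup (real_points (op_spectrum A))"
  shows "has_gap (real_points (essential_spectrum A))"
proof -
  note A = assms(1) and sa = assms(2) and ev = assms(4)
  define S where "S = real_points (op_spectrum A)"
  define S\<^sub>e where "S\<^sub>e = real_points (essential_spectrum A)"
  have e: "orthonormal_on UNIV e"
    using assms(3) by (auto simp: orthonormal_basis_def orthonormal_on_def)
  have "e 0 \<noteq> 0"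
    using e unfolding orthonormal_on_def by (metis UNIV_I cinner_zero_left zero_neq_one)
  then have "\<exists>x::'a. x \<noteq> 0"
    by blast
  from quadratic_form_spectrum_bounds(1,2)[OF A sa this]
  have bdd_S: "bdd_below S" "bdd_above S"
    by (simp_all add: S_def)
  have "S\<^sub>e \<subseteq> S"
    using essential_spectrum_subset[OF A] by (auto simp: S_def S\<^sub>e_def real_points_def)
  with bdd_S have bdd: "bdd_below S\<^sub>e" "bdd_above S\<^sub>e"
    using bdd_below_mono[of S S\<^sub>e] bdd_above_mono[of S S\<^sub>e] by simp_all
  have "S\<^sub>e \<noteq> {}"
    unfolding S\<^sub>e_def using essential_spectrum_nonempty[OF A sa e] .
  have bounds: "Inf S = Inf S\<^sub>e" "Sup S = Sup S\<^sub>e"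
    using assms(8,9) by (simp_all add: S_def S\<^sub>e_def)

  define a where "a = (\<lambda>n. \<Sum>k<n. w n k * lam n k)"
  have a_bounds: "a n \<in> {Inf S\<^sub>e..Sup S\<^sub>e}" if "n \<ge> 1" for n
  proof -
    have lam: "Inf S\<^sub>e \<le> lam n k" "lam n k \<le> Sup S\<^sub>e" if "k < n" for k
      using eigenvalue_between_spectrum_bounds[OF A sa e ev[OF \<open>n \<ge> 1\<close>] that] bounds
      by (simp_all add: S_def)
    have avg: "(\<Sum>k<n. w n k * c) = c" for c
      using assms(6)[OF that] by (simp flip: sum_distrib_right)
    have "(\<Sum>k<n. w n k * Inf S\<^sub>e) \<le> a n"
      unfolding a_def using lam assms(5)[OF that] by (intro sum_mono mult_left_mono) auto
    moreover have "a n \<le> (\<Sum>k<n. w n k * Sup S\<^sub>e)"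
      unfolding a_def using lam assms(5)[OF that] by (intro sum_mono mult_left_mono) auto
    ultimately show ?thesis
      by (simp add: avg)
  qed
  \<comment> \<open>the index is shifted because the mean is a mean of eigenvalues only for \<open>n \<ge> 1\<close>\<close>
  obtain c r where c: "c \<in> {Inf S\<^sub>e..Sup S\<^sub>e}" "strict_mono r" "(\<lambda>n. a (Suc (r n))) \<longlonglongrightarrow> c"
    using seq_compactE[OF compact_imp_seq_compact[OF compact_Icc], of "\<lambda>n. a (Suc n)" "Inf S\<^sub>e" "Sup S\<^sub>e"]
      a_bounds by (auto simp: o_def)

  obtain \<delta> K where \<delta>: "\<delta> > 0"
    "\<And>n. n \<ge> 1 \<Longrightarrow> real (card {j. j < n \<and> \<bar>a n - lam n j\<bar> < \<delta>}) < K"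
    using assms(7) by (auto simp: a_def)
  have no_point: "t \<notin> S\<^sub>e" if "t \<in> {c - \<delta> / 2<..<c + \<delta> / 2}" for t
  proof
    assume "t \<in> S\<^sub>e"
    define \<rho> where "\<rho> = (\<delta> / 2 - \<bar>t - c\<bar>) / 2"
    have \<rho>: "\<rho> > 0" "\<bar>t - c\<bar> + 2 * \<rho> = \<delta> / 2"
      using that by (auto simp: \<rho>_def field_simps abs_if)
    obtain n0 where n0: "\<And>n. n \<ge> n0 \<Longrightarrow> nat \<lceil>K\<rceil> \<le> card {j. j < n \<and> \<bar>lam n j - t\<bar> < \<rho>}"
      using many_eigenvalues_near_essential_spectrum[OF A sa assms(3) ev, of t \<rho>] \<open>t \<in> S\<^sub>e\<close> \<rho>(1)
      by (metis S\<^sub>e_def)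
    have "\<forall>\<^sub>F n in sequentially. dist (a (Suc (r n))) c < \<delta> / 2"
      using c(3) \<delta>(1) by (intro tendstoD) auto
    then obtain n1 where n1: "\<And>n. n \<ge> n1 \<Longrightarrow> dist (a (Suc (r n))) c < \<delta> / 2"
      by (auto simp: eventually_sequentially)
    define n where "n = max n0 n1"
    have n: "n \<ge> n0" "dist (a (Suc (r n))) c < \<delta> / 2"
      using n1[of n] by (simp_all add: n_def)
    define q where "q = Suc (r n)"
    have q: "q \<ge> n0" "q \<ge> 1"
      using n(1) seq_suble[OF c(2), of n] by (simp_all add: q_def)
    have "{j. j < q \<and> \<bar>lam q j - t\<bar> < \<rho>} \<subseteq> {j. j < q \<and> \<bar>a q - lam q j\<bar> < \<delta>}"
    proof safe
      fix j
      assume "\<bar>lam q j - t\<bar> < \<rho>"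
      moreover have "\<bar>a q - c\<bar> < \<delta> / 2"
        using n(2) by (simp add: dist_real_def q_def)
      ultimately show "\<bar>a q - lam q j\<bar> < \<delta>"
        using \<rho> by linarith
    qed
    then have "card {j. j < q \<and> \<bar>lam q j - t\<bar> < \<rho>} \<le> card {j. j < q \<and> \<bar>a q - lam q j\<bar> < \<delta>}"
      by (intro card_mono) auto
    with n0[OF q(1)] have "nat \<lceil>K\<rceil> \<le> card {j. j < q \<and> \<bar>a q - lam q j\<bar> < \<delta>}"
      by linarith
    with \<delta>(2)[OF q(2)] show False
      by linarith
  qed

  \<comment> \<open>the infimum and the supremum of \<open>S\<^sub>e\<close> are limits of points of \<open>S\<^sub>e\<close>,
    so neither can lie inside the interval\<close>
  have "Inf S\<^sub>e \<le> c - \<delta> / 2"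
  proof (rule ccontr)
    assume *: "\<not> Inf S\<^sub>e \<le> c - \<delta> / 2"
    have "Inf S\<^sub>e < c + \<delta> / 2"
      using c(1) \<delta>(1) by simp
    then obtain t where "t \<in> S\<^sub>e" "t < c + \<delta> / 2"
      using cInf_lessD[OF \<open>S\<^sub>e \<noteq> {}\<close>] by blast
    moreover have "c - \<delta> / 2 < t"
      using * cInf_lower[OF \<open>t \<in> S\<^sub>e\<close> bdd(1)] by simp
    ultimately show False
      using no_point[of t] by simp
  qed
  moreover have "c + \<delta> / 2 \<le> Sup S\<^sub>e"
  proof (rule ccontr)
    assume *: "\<not> c + \<delta> / 2 \<le> Sup S\<^sub>e"
    have "c - \<delta> / 2 < Sup S\<^sub>e"
      using c(1) \<delta>(1) by simp
    then obtain t where "t \<in> S\<^sub>e" "c - \<delta> / 2 < t"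
      using less_cSupD[OF \<open>S\<^sub>e \<noteq> {}\<close>] by blast
    moreover have "t < c + \<delta> / 2"
      using * cSup_upper[OF \<open>t \<in> S\<^sub>e\<close> bdd(2)] by simp
    ultimately show False
      using no_point[of t] by simp
  qed
  ultimately show ?thesis
    unfolding has_gap_def S\<^sub>e_def[symmetric]
    using \<delta>(1) no_point by (intro exI[of _ "c - \<delta> / 2"] exI[of _ "c + \<delta> / 2"]) auto
qed

end
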